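(* Let $m\geq 2$, let $\vec{q_i}=(q_{i1},\dots,q_{in})$ with $1<\vec{q_i}<\infty$ (that is, $1<q_{ij}<\infty$ for $j=1,\dots,n$) for all $i=1,\dots,m$, and let $\vec q=(q_1,\dots,q_n)$ be given by $1/\vec q=1/\vec{q_1}+\cdots+1/\vec{q_m}$ (componentwise: $1/q_j=\sum_{i=1}^m 1/q_{ij}$). Let $\varphi,\varphi_1,\dots,\varphi_m:\mathbb{R}^n\times(0,\infty)\to(0,\infty)$ be Lebesgue measurable functions satisfying $$\prod_{i=1}^m\int_r^\infty\frac{\varphi_i(x,t)}{t}\,dt\le C_0\,\varphi(x,r)$$ with a constant $C_0>0$ independent of $x\in\mathbb R^n$ and $r>0$. If $T_m$ is a multi-sublinear operator which satisfies the size condition (S) and is bounded from $L^{\vec{q_1}}(\mathbb{R}^n)\times\cdots\times L^{\vec{q_m}}(\mathbb{R}^n)$ to $L^{\vec{q}}(\mathbb{R}^n)$, then $T_m$ is also bounded from the product space $M^{\varphi_1}_{\vec{q_1}}(\mathbb{R}^n)\times\cdots\times M^{\varphi_m}_{\vec{q_m}}(\mathbb{R}^n)$ to $M^{\varphi}_{\vec{q}}(\mathbb{R}^n)$.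
   Context: Mixed Lebesgue spaces: for $\vec p=(p_1,\dots,p_n)\in(0,\infty]^n$ and measurable $f:\mathbb{R}^n\to\mathbb{C}$, $$\|f\|_{L^{\vec p}}=\left(\int_{\mathbb R}\cdots\left(\int_{\mathbb R}\left(\int_{\mathbb R}|f(x_1,\dots,x_n)|^{p_1}dx_1\right)^{p_2/p_1}dx_2\right)^{p_3/p_2}\cdots dx_n\right)^{1/p_n}$$ (with the usual modification if some $p_j=\infty$), and $L^{\vec p}(\mathbb R^n)$ is the set of $f$ with $\|f\|_{L^{\vec p}}<\infty$. Generalized mixed Morrey spaces: for $1\le\vec q<\infty$ and a Lebesgue measurable $\varphi:\mathbb R^n\times(0,\infty)\to(0,\infty)$, $M^{\varphi}_{\vec q}(\mathbb R^n)$ is the set of measurable $f$ with $$\|f\|_{M^{\varphi}_{\vec q}}=\sup_{x\in\mathbb R^n,\,r>0}\varphi(x,r)^{-1}\|\chi_{B(x,r)}\|_{L^{\vec q}}^{-1}\|f\chi_{B(x,r)}\|_{L^{\vec q}}<\infty,$$ where $B(x,r)$ is the open ball with center $x$ and radius $r$. (The theorem itself writes no lower bound on the target exponent $\vec q$; $M^\varphi_{\vec q}$ in it denotes the space given by this formula.) Multi-sublinear means sublinear in each of the $m$ arguments when the others are fixed. Size condition (S): for any $\vec f=(f_1,\dots,f_m)\in L^1(\mathbb R^n)\times\cdots\times L^1(\mathbb R^n)$ with compact support and any $x\notin\bigcap_{j=1}^m\operatorname{supp}f_j$, $$|T_m(\vec f)(x)|\le C\int_{(\mathbb R^n)^m}\frac{|f_1(y_1)\cdots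 f_m(y_m)|}{|(x-y_1,\dots,x-y_m)|^{mn}}\,dy_1\cdots dy_m,$$ where $C$ is independent of $\vec f$ and $x$. Boundedness of $T_m$ from $X_1\times\cdots\times X_m$ to $Y$ means $\|T_m(\vec f)\|_Y\le C\prod_{i=1}^m\|f_i\|_{X_i}$ with $C$ independent of $\vec f$.
   Formalization: Added, since (S) and Lebesgue boundedness do not constrain T_m beyond L^{q_i} and compactly supported L^1: for Morrey tuples with some f_i not in L^{q_i}, |T_m(f)| ≤ liminf_N |T_m(f χ_{B(0,N)})| a.e. (without it, bilinear functionals vanishing on these spaces are counterexamples). *)

theory Defs
  imports "HOL-Analysis.Analysis" "HOL-Probability.Essential_Supremum"
begin

section \<open>Mixed Lebesgue spaces\<close>

definition ennreal_powr :: "ennreal \<Rightarrow> real \<Rightarrow> ennreal" where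
  "ennreal_powr a s = (if a = \<infinity> then \<infinity> else ennreal (enn2real a powr s))"

text \<open>Only exponents in \<open>(0, \<infinity>]\<close> are meaningful below.\<close>

definition Lp_norm_1 :: "ennreal \<Rightarrow> (real \<Rightarrow> ennreal) \<Rightarrow> ennreal" where
  "Lp_norm_1 p g =
     (if p = \<infinity> then esssup lebesgue g
      else ennreal_powr (\<integral>\<^sup>+ t. ennreal_powr (g t) (enn2real p) \<partial>lebesgue) (1 / enn2real p))"

definition coord_upd :: "real ^ 'n \<Rightarrow> 'n \<Rightarrow> real \<Rightarrow> real ^ 'n" where
  "coord_upd x j t = (\<chi> k. if k = j then t else x $ k)"

text \<open>
  \<open>iterated_norm p js F\<close> takes the norms in the coordinates listed in \<open>js\<close>, the head of the
  list being the innermost one.  The exponents \<open>p\<^sub>j\<^sub>+\<^sub>1 / p\<^sub>j\<close> of the usual formula come from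
  raising the \<open>j\<close>-th norm, which carries the root \<open>1 / p\<^sub>j\<close>, to the power \<open>p\<^sub>j\<^sub>+\<^sub>1\<close>.
\<close>

primrec iterated_norm ::
  "('n \<Rightarrow> ennreal) \<Rightarrow> 'n list \<Rightarrow> (real ^ 'n \<Rightarrow> ennreal) \<Rightarrow> real ^ 'n \<Rightarrow> ennreal" where
  "iterated_norm p [] F = F"
| "iterated_norm p (j # js) F =
     iterated_norm p js (\<lambda>x. Lp_norm_1 (p j) (\<lambda>t. F (coord_upd x j t)))"

text \<open>
  The linear order of the finite index type \<open>'n\<close> orders the coordinates as \<open>x\<^sub>1, \<dots>, x\<^sub>n\<close>.
  Once all norms have been taken the result no longer depends on the point, so it is read
  off at \<open>0\<close>.
\<close>

definition mixed_norm ::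
  "('n \<Rightarrow> ennreal) \<Rightarrow> (real ^ 'n::{finite,linorder} \<Rightarrow> complex) \<Rightarrow> ennreal" where
  "mixed_norm p f =
     iterated_norm p (sorted_list_of_set UNIV) (\<lambda>x. ennreal (cmod (f x))) 0"

definition mixed_Lebesgue ::
  "('n \<Rightarrow> ennreal) \<Rightarrow> (real ^ 'n::{finite,linorder} \<Rightarrow> complex) set" where
  "mixed_Lebesgue p = {f \<in> borel_measurable lebesgue. mixed_norm p f < \<infinity>}"


section \<open>Generalized mixed Morrey spaces\<close>

definition morrey_norm ::
  "(real ^ 'n::{finite,linorder} \<Rightarrow> real \<Rightarrow> real) \<Rightarrow> ('n \<Rightarrow> real) \<Rightarrow>
     (real ^ 'n::{finite,linorder} \<Rightarrow> complex) \<Rightarrow> ennreal" where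
  "morrey_norm \<phi> q f =
     (SUP (x, r) \<in> UNIV \<times> {0<..}.
        inverse (ennreal (\<phi> x r)) *
        inverse (mixed_norm (\<lambda>j. ennreal (q j)) (indicator (ball x r))) *
        mixed_norm (\<lambda>j. ennreal (q j)) (\<lambda>y. f y * indicator (ball x r) y))"

definition morrey_space ::
  "(real ^ 'n::{finite,linorder} \<Rightarrow> real \<Rightarrow> real) \<Rightarrow> ('n \<Rightarrow> real) \<Rightarrow>
     (real ^ 'n::{finite,linorder} \<Rightarrow> complex) set" where
  "morrey_space \<phi> q = {f \<in> borel_measurable lebesgue. morrey_norm \<phi> q f < \<infinity>}"

text \<open>Lebesgue measurable functions from \<open>\<real>\<^sup>n \<times> (0, \<infinity>)\<close> to \<open>(0, \<infinity>)\<close>; values at \<open>r \<le> 0\<close> are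
  never used.\<close>

definition morrey_weight :: "(real ^ 'n \<Rightarrow> real \<Rightarrow> real) \<Rightarrow> bool" where
  "morrey_weight \<phi> \<longleftrightarrow>
     (\<forall>x. \<forall>r>0. \<phi> x r > 0) \<and>
     (\<lambda>(x, r). \<phi> x r) \<in> borel_measurable (lebesgue_on (UNIV \<times> {0<..}))"


section \<open>Multi-sublinear operators\<close>

definition closed_support :: "(real ^ 'n \<Rightarrow> complex) \<Rightarrow> (real ^ 'n) set" where
  "closed_support f = closure {y. f y \<noteq> 0}"

definition L1_compact :: "(real ^ 'n \<Rightarrow> complex) set" where
  "L1_compact = {f. integrable lebesgue f \<and> compact (closed_support f)}"

definition function_space :: "(real ^ 'n \<Rightarrow> complex) set \<Rightarrow> bool" where
  "function_space V \<longleftrightarrow>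
     V \<subseteq> borel_measurable lebesgue \<and> (\<lambda>_. 0) \<in> V \<and>
     (\<forall>f\<in>V. \<forall>g\<in>V. (\<lambda>x. f x + g x) \<in> V) \<and>
     (\<forall>f\<in>V. \<forall>c. (\<lambda>x. c * f x) \<in> V)"

text \<open>
  Tuples \<open>(f\<^sub>1, \<dots>, f\<^sub>m)\<close> are functions on the finite index type \<open>'m\<close>.  The values of an operator
  are functions up to null sets, hence the almost-everywhere inequalities.
\<close>

definition multi_sublinear ::
  "('m \<Rightarrow> (real ^ 'n \<Rightarrow> complex) set) \<Rightarrow>
     (('m::finite \<Rightarrow> real ^ 'n \<Rightarrow> complex) \<Rightarrow> real ^ 'n \<Rightarrow> complex) \<Rightarrow> bool" where
  "multi_sublinear V T \<longleftrightarrow>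
     (\<forall>f. (\<forall>k. f k \<in> V k) \<longrightarrow>
       T f \<in> borel_measurable lebesgue \<and>
       (\<forall>i. \<forall>g\<in>V i. AE x in lebesgue.
          cmod (T (f(i := (\<lambda>y. f i y + g y))) x) \<le> cmod (T f x) + cmod (T (f(i := g)) x)) \<and>
       (\<forall>i c. AE x in lebesgue.
          cmod (T (f(i := (\<lambda>y. c * f i y))) x) = cmod c * cmod (T f x)))"

definition size_condition ::
  "(('m::finite \<Rightarrow> real ^ 'n::finite \<Rightarrow> complex) \<Rightarrow> real ^ 'n \<Rightarrow> complex) \<Rightarrow> bool" where
  "size_condition T \<longleftrightarrow>
     (\<exists>C::real. \<forall>f x. (\<forall>i. f i \<in> L1_compact) \<and> x \<notin> (\<Inter>i. closed_support (f i)) \<longrightarrow>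
        ennreal (cmod (T f x)) \<le>
          ennreal C * (\<integral>\<^sup>+ y. ennreal ((\<Prod>i\<in>UNIV. cmod (f i (y $ i))) /
                 norm (\<chi> i. x - y $ i) ^ (CARD('m) * CARD('n)))
              \<partial>(lebesgue :: ((real ^ 'n) ^ 'm) measure)))"

definition bounded_multi ::
  "(('m::finite \<Rightarrow> real ^ 'n \<Rightarrow> complex) \<Rightarrow> real ^ 'n \<Rightarrow> complex) \<Rightarrow>
     ('m \<Rightarrow> (real ^ 'n \<Rightarrow> complex) set) \<Rightarrow> ('m \<Rightarrow> (real ^ 'n \<Rightarrow> complex) \<Rightarrow> ennreal) \<Rightarrow>
     (real ^ 'n \<Rightarrow> complex) set \<Rightarrow> ((real ^ 'n \<Rightarrow> complex) \<Rightarrow> ennreal) \<Rightarrow> bool" where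
  "bounded_multi T X normX Y normY \<longleftrightarrow>
     (\<exists>C::real. \<forall>f. (\<forall>i. f i \<in> X i) \<longrightarrow>
        T f \<in> Y \<and> normY (T f) \<le> ennreal C * (\<Prod>i\<in>UNIV. normX i (f i)))"

text \<open>
  Morrey functions need not be globally in a mixed Lebesgue space, and where they are not, neither
  the size condition nor boundedness on Lebesgue spaces constrains an operator: for linear
  functionals \<open>\<Lambda>\<^sub>1\<close>, \<open>\<Lambda>\<^sub>2\<close> that vanish on all sums of a mixed Lebesgue function and a compactly supported
  integrable one, but not on all Morrey functions, and any fixed measurable \<open>g\<close>, the bilinear operator
  \<open>T(f\<^sub>1, f\<^sub>2) = \<Lambda>\<^sub>1(f\<^sub>1) \<Lambda>\<^sub>2(f\<^sub>2) g\<close> satisfies both.  The value of an operator at such a tuple is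
  therefore understood through the truncations \<open>f\<^sub>N\<close> of the tuple to the balls \<open>B(0, N)\<close>.  Each of
  \<open>T f = lim T f\<^sub>N\<close> and \<open>\<bar>T f\<bar> = lim \<bar>T f\<^sub>N\<bar>\<close> (almost everywhere) implies the inequality below.
\<close>

definition truncation_controlled ::
  "(('m \<Rightarrow> real ^ 'n \<Rightarrow> complex) \<Rightarrow> real ^ 'n \<Rightarrow> complex) \<Rightarrow>
     ('m \<Rightarrow> real ^ 'n \<Rightarrow> complex) \<Rightarrow> bool" where
  "truncation_controlled T f \<longleftrightarrow>
     (AE x in lebesgue. ennreal (cmod (T f x)) \<le>
        liminf (\<lambda>N. ennreal (cmod (T (\<lambda>i y. f i y * indicator (ball 0 (real N)) y) x))))"

end

theory Submission
  imports Defs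
begin

text \<open>
  Fix a ball \<open>B = B(x, r)\<close> and split every (truncated) argument into its parts inside and outside
  \<open>2B\<close>.  The term with all parts inside \<open>2B\<close> is controlled by boundedness on mixed Lebesgue spaces.
  In each of the other terms one variable keeps distance \<open>r\<close> from \<open>B\<close>, so that the kernel of the
  size condition is at most a multiple of \<open>\<Prod>\<^sub>i max(r, \<bar>x - y\<^sub>i\<bar>)\<^sup>-\<^sup>n\<close> and the term is
  pointwise bounded on \<open>B\<close> by \<open>\<Prod>\<^sub>i \<integral> \<bar>f\<^sub>i(y)\<bar> max(r, \<bar>x - y\<bar>)\<^sup>-\<^sup>n dy\<close>.  Writing
  \<open>max(r, \<bar>x - y\<bar>)\<^sup>-\<^sup>n\<close> as an integral of \<open>t\<^sup>-\<^sup>n\<^sup>-\<^sup>1\<close> over \<open>t > max(r, \<bar>x - y\<bar>)\<close>,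
  Hoelder's inequality on \<open>B(x, t)\<close> bounds each factor by the Morrey norm times
  \<open>\<integral>\<^sub>r\<^sup>\<infinity> \<phi>\<^sub>i(x, t) / t dt\<close>.  As the target exponents may be below one, only a
  quasi-triangle inequality is available there.
\<close>

section \<open>Slices of Cartesian products\<close>

text \<open>Three obstacles shape the details. Mixed norms are defined by slicing, but slices of a
  Lebesgue measurable function need not be measurable; norms are therefore computed on Borel
  representatives, once changes on null sets are known not to affect them. The hypotheses on
  \<open>T\<close> speak of arguments that are mixed Lebesgue or integrable with compact support,
  and a Morrey function is in general neither; only cutoffs can be split, and the far terms must be
  bounded independently of the cutoff radius. Finally, the weights are linked only through the
  integrals of \<open>\<phi>s i x t / t\<close> over \<open>t > r\<close>, and a weight need not be
  monotone in \<open>t\<close>; hence the near term, too, has to be turned into such an integral, by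
  averaging over radii.

  Homogeneity makes the parts fit: the norm of the indicator of B(x, r) is comparable to
  \<open>r powr (\<Sum>j\<in>UNIV. 1 / q j)\<close>, and the corresponding exponents for the
  \<open>qs i\<close> add up to this one. Constants are free, so losses in Hoelder's inequality, in
  sums and in comparing balls with cubes are accepted throughout.\<close>

lemma nn_integral_lborel_translate:
  fixes c :: "'a::euclidean_space"
  assumes [measurable]: "f \<in> borel_measurable borel"
  shows "(\<integral>\<^sup>+ x. f (c + x) \<partial>lborel) = (\<integral>\<^sup>+ x. f x \<partial>lborel)"
proof -
  have "(\<integral>\<^sup>+ x. f x \<partial>lborel) = (\<integral>\<^sup>+ x. f x \<partial>distr lborel borel ((+) c))"
    by (simp add: lborel_distr_plus)
  also have "\<dots> = (\<integral>\<^sup>+ x. f (c + x) \<partial>lborel)"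
    by (rule nn_integral_distr) auto
  finally show ?thesis by simp
qed

text \<open>The entry type is left arbitrary so that the same slicing serves the coordinates of one
  point and the tuples of points over which the size condition integrates.\<close>

definition vec_upd :: "'a ^ 'k \<Rightarrow> 'k \<Rightarrow> 'a \<Rightarrow> 'a ^ 'k" where
  "vec_upd y i v = (\<chi> k. if k = i then v else y $ k)"

lemma vec_upd_nth [simp]: "vec_upd y i v $ k = (if k = i then v else y $ k)"
  by (simp add: vec_upd_def)

lemma coord_upd_eq_vec_upd: "coord_upd = vec_upd"
  by (simp add: fun_eq_iff coord_upd_def vec_upd_def)

text \<open>Overwriting an entry is a translation along an axis; this gives measurability and brings
  in the translation invariance of Lebesgue measure.\<close>

lemma vec_upd_eq_add_axis:
  fixes y :: "'a::euclidean_space ^ 'k"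
  shows "vec_upd y i v = y + axis i (v - y $ i)"
  by (simp add: vec_eq_iff axis_def)

lemma continuous_axis: "continuous_on UNIV (axis i :: 'a::euclidean_space \<Rightarrow> 'a ^ 'k)"
proof -
  have "bounded_linear (axis i :: 'a \<Rightarrow> 'a ^ 'k)"
    by (rule linear_linear[THEN iffD2]) (auto intro!: linearI simp: vec_eq_iff axis_def)
  then show ?thesis by (rule linear_continuous_on)
qed

lemma measurable_axis [measurable]:
  "(axis i :: 'a::euclidean_space \<Rightarrow> 'a ^ 'k) \<in> borel_measurable borel"
  by (rule borel_measurable_continuous_onI[OF continuous_axis])

lemma measurable_vec_nth [measurable]:
  "(\<lambda>x :: 'a::euclidean_space ^ 'k. x $ i) \<in> borel_measurable borel"
  by (rule borel_measurable_continuous_onI) (intro continuous_intros)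

lemma measurable_vec_upd [measurable (raw)]:
  fixes f :: "'c \<Rightarrow> 'a::euclidean_space ^ 'k"
  assumes [measurable]: "f \<in> borel_measurable M" "g \<in> borel_measurable M"
  shows "(\<lambda>x. vec_upd (f x) i (g x)) \<in> borel_measurable M"
  unfolding vec_upd_eq_add_axis by measurable

lemma lborel_distr_uminus_euclidean:
  "distr lborel borel (uminus :: 'a::euclidean_space \<Rightarrow> 'a) = lborel"
  using lborel_affine[of "-1" "0::'a"] by (simp add: density_1)

text \<open>The double integral replaces a product decomposition of the space: translating
  \<open>y\<close> by \<open>axis i v\<close> removes \<open>v\<close> from \<open>F\<close> and
  puts it into the indicator, after which the integral over \<open>v\<close> is the measure of
  \<open>U\<close>. The indicator controls the overwritten entry, over which \<open>y\<close> still
  runs. With \<open>U\<close> of measure one this is Tonelli's theorem.\<close>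

lemma nn_integral_slice:
  fixes F :: "'a::euclidean_space ^ 'k \<Rightarrow> ennreal"
  assumes [measurable]: "F \<in> borel_measurable borel" "U \<in> sets borel"
  shows "(\<integral>\<^sup>+ y. indicator U (y $ i) * (\<integral>\<^sup>+ v. F (vec_upd y i v) \<partial>lborel) \<partial>lborel) =
    emeasure lborel U * (\<integral>\<^sup>+ y. F y \<partial>lborel)"
proof -
  have inner: "(\<integral>\<^sup>+ v. F (vec_upd y i v) \<partial>lborel) = (\<integral>\<^sup>+ v. F (y + axis i v) \<partial>lborel)" for y
  proof -
    have "(\<integral>\<^sup>+ v. F (vec_upd y i v) \<partial>lborel) = (\<integral>\<^sup>+ v. F (vec_upd y i (y $ i + v)) \<partial>lborel)"
      by (rule nn_integral_lborel_translate[symmetric]) measurable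
    then show ?thesis by (simp add: vec_upd_eq_add_axis)
  qed
  have "(\<integral>\<^sup>+ y. indicator U (y $ i) * (\<integral>\<^sup>+ v. F (vec_upd y i v) \<partial>lborel) \<partial>lborel) =
      (\<integral>\<^sup>+ y. (\<integral>\<^sup>+ v. indicator U (y $ i) * F (y + axis i v) \<partial>lborel) \<partial>lborel)"
    unfolding inner by (subst nn_integral_cmult) auto
  also have "\<dots> = (\<integral>\<^sup>+ v. (\<integral>\<^sup>+ y. indicator U (y $ i) * F (y + axis i v) \<partial>lborel) \<partial>lborel)"
    by (rule lborel_pair.Fubini'[symmetric]) measurable
  also have "\<dots> = (\<integral>\<^sup>+ v. (\<integral>\<^sup>+ y. indicator U (y $ i - v) * F y \<partial>lborel) \<partial>lborel)"
  proof (rule nn_integral_cong)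
    fix v :: 'a
    have "(\<integral>\<^sup>+ y. indicator U (y $ i - v) * F y \<partial>lborel) =
        (\<integral>\<^sup>+ y. indicator U ((axis i v + y) $ i - v) * F (axis i v + y) \<partial>lborel)"
      by (rule nn_integral_lborel_translate[symmetric]) measurable
    then show "(\<integral>\<^sup>+ y. indicator U (y $ i) * F (y + axis i v) \<partial>lborel) =
        (\<integral>\<^sup>+ y. indicator U (y $ i - v) * F y \<partial>lborel)"
      by (simp add: axis_def add.commute)
  qed
  also have "\<dots> = (\<integral>\<^sup>+ y. (\<integral>\<^sup>+ v. indicator U (y $ i - v) * F y \<partial>lborel) \<partial>lborel)"
    by (rule lborel_pair.Fubini') measurable
  also have "\<dots> = (\<integral>\<^sup>+ y. emeasure lborel U * F y \<partial>lborel)"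
  proof (rule nn_integral_cong)
    fix y :: "'a ^ 'k"
    have "(\<integral>\<^sup>+ v. indicator U (y $ i - v) \<partial>(lborel :: 'a measure)) = (\<integral>\<^sup>+ v. indicator U (y $ i + v) \<partial>lborel)"
    proof -
      have "(\<integral>\<^sup>+ v. indicator U (y $ i + v) \<partial>(lborel :: 'a measure)) =
          (\<integral>\<^sup>+ v. indicator U (y $ i + v) \<partial>distr lborel borel uminus)"
        by (simp add: lborel_distr_uminus_euclidean)
      also have "\<dots> = (\<integral>\<^sup>+ v. indicator U (y $ i + (- v)) \<partial>lborel)"
        by (rule nn_integral_distr) measurable
      finally show ?thesis by simp
    qed
    also have "\<dots> = emeasure lborel U"
      by (subst nn_integral_lborel_translate) auto
    finally show "(\<integral>\<^sup>+ v. indicator U (y $ i - v) * F y \<partial>lborel) = emeasure lborel U * F y"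
      by (subst nn_integral_multc) auto
  qed
  also have "\<dots> = emeasure lborel U * (\<integral>\<^sup>+ y. F y \<partial>lborel)"
    by (rule nn_integral_cmult) measurable
  finally show ?thesis .
qed

text \<open>Slicing with \<open>U = UNIV\<close> produces an infinite factor, which does not change
  whether the integral of the indicator of \<open>N\<close> vanishes.\<close>

lemma null_slice_iff:
  fixes N :: "('a::euclidean_space ^ 'k) set"
  assumes [measurable]: "N \<in> sets borel"
  shows "(AE y in lborel. y \<notin> N) \<longleftrightarrow> (AE y in lborel. AE v in lborel. vec_upd y i v \<notin> N)"
proof -
  have "(AE y in lborel. AE v in lborel. vec_upd y i v \<notin> N) \<longleftrightarrow>
      (AE y in lborel. (\<integral>\<^sup>+ v. indicator N (vec_upd y i v) \<partial>lborel) = (0::ennreal))"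
    by (subst nn_integral_0_iff_AE) (auto simp: indicator_def)
  also have "\<dots> \<longleftrightarrow> (\<integral>\<^sup>+ y. (\<integral>\<^sup>+ v. indicator N (vec_upd y i v) \<partial>lborel) \<partial>lborel) = (0::ennreal)"
    by (rule nn_integral_0_iff_AE[symmetric]) measurable
  also have "\<dots> \<longleftrightarrow> emeasure (lborel :: 'a measure) UNIV * (\<integral>\<^sup>+ y. indicator N y \<partial>lborel) = 0"
    using nn_integral_slice[of "indicator N" UNIV i] by simp
  also have "\<dots> \<longleftrightarrow> (AE y in lborel. y \<notin> N)"
    by (simp add: nn_integral_0_iff_AE indicator_def AE_iff_null emeasure_lborel_UNIV)
  finally show ?thesis by simp
qed

lemma AE_sliceI:
  fixes P :: "'a::euclidean_space ^ 'k \<Rightarrow> bool"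
  assumes "AE y in lborel. P y"
  shows "AE y in lborel. AE v in lborel. P (vec_upd y i v)"
proof -
  obtain N where N: "\<And>y. y \<notin> N \<Longrightarrow> P y" "N \<in> null_sets lborel"
    using AE_E3[OF assms] by auto
  then have "AE y in lborel. y \<notin> N" and [measurable]: "N \<in> sets borel"
    by (auto intro: AE_not_in)
  then show ?thesis
    using N(1) null_slice_iff[of N i] by (auto elim!: eventually_mono)
qed

text \<open>The exceptional set has to be Borel here, since null slices alone say nothing about a
  non-measurable set. In the opposite direction the exceptions can be enclosed in a Borel null
  set.\<close>

lemma AE_sliceD:
  fixes P :: "'a::euclidean_space ^ 'k \<Rightarrow> bool"
  assumes "AE y in lborel. AE v in lborel. P (vec_upd y i v)"
    and [measurable]: "Measurable.pred borel P"
  shows "AE y in lborel. P y"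
  using null_slice_iff[of "{y. \<not> P y}" i] assms(1) by simp

text \<open>A cylinder over a null set is null, as its slices in direction \<open>i\<close> are that
  null set. This carries Borel representatives of single arguments over to tuples.\<close>

lemma AE_component:
  fixes P :: "'a::euclidean_space \<Rightarrow> bool"
  assumes "AE v in lborel. P v"
  shows "AE y :: 'a ^ 'k in lborel. P (y $ i)"
proof -
  obtain N where N: "\<And>v. v \<notin> N \<Longrightarrow> P v" "N \<in> null_sets lborel"
    using AE_E3[OF assms] by auto
  then have ae: "AE v in lborel. v \<notin> N" and [measurable]: "N \<in> sets borel"
    by (auto intro: AE_not_in)
  have "AE y :: 'a ^ 'k in lborel. y $ i \<notin> N"
    by (rule AE_sliceD[where i = i]) (use ae in auto)
  then show ?thesis
    using N(1) by (auto elim!: eventually_mono)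
qed

text \<open>The unit cube in the coordinates outside \<open>S\<close> has measure one, so it can hold the place of
  factors that have not been introduced yet.\<close>

lemma nn_integral_prod_vec_aux:
  fixes F :: "'k::finite \<Rightarrow> 'a::euclidean_space \<Rightarrow> ennreal"
  assumes F [measurable]: "\<And>i. F i \<in> borel_measurable borel"
  shows "(\<integral>\<^sup>+ y. (\<Prod>i\<in>UNIV. if i \<in> S then F i (y $ i) else indicator (cbox 0 One) (y $ i))
      \<partial>(lborel :: ('a ^ 'k) measure)) = (\<Prod>i\<in>S. \<integral>\<^sup>+ v. F i v \<partial>lborel)"
  using finite[of S]
proof (induction S rule: finite_induct)
  case empty
  have "(\<Prod>i\<in>UNIV. indicator (cbox 0 One) (y $ i)) = (indicator (cbox 0 One) y :: ennreal)"
    for y :: "'a ^ 'k"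
  proof -
    have "y \<in> cbox 0 One \<longleftrightarrow> (\<forall>i. y $ i \<in> cbox 0 One)"
    proof -
      have "y \<in> cbox 0 One \<longleftrightarrow> (\<forall>b\<in>Basis. 0 \<le> y \<bullet> b \<and> y \<bullet> b \<le> 1)"
        by (simp add: mem_box)
      also have "\<dots> \<longleftrightarrow> (\<forall>i. \<forall>u\<in>Basis. 0 \<le> y $ i \<bullet> u \<and> y $ i \<bullet> u \<le> 1)"
        by (auto simp: Basis_vec_def inner_axis)
      finally show ?thesis
        by (simp add: mem_box)
    qed
    then show ?thesis
      by (auto simp: indicator_def)
  qed
  then show ?case by simp
next
  case (insert j S)
  define R :: "'a ^ 'k \<Rightarrow> ennreal" where
    "R y = (\<Prod>i\<in>UNIV - {j}. if i \<in> S then F i (y $ i) else indicator (cbox 0 One) (y $ i))" for y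
  have [measurable]: "R \<in> borel_measurable borel" unfolding R_def by measurable
  have R_upd: "R (vec_upd y j v) = R y" for y v
    unfolding R_def by (rule prod.cong) auto
  let ?I = "\<lambda>G. \<integral>\<^sup>+ y. G y \<partial>(lborel :: ('a ^ 'k) measure)"
  have one: "emeasure lborel (cbox (0::'a) One) = 1"
    by simp
  \<comment> \<open>Slicing integrates out \<open>F j\<close> and leaves the unit cube in entry
    \<open>j\<close>, which is the shape of the induction hypothesis.\<close>
  have "?I (\<lambda>y. F j (y $ j) * R y) =
      ?I (\<lambda>y. indicator (cbox 0 One) (y $ j) * (\<integral>\<^sup>+ v. F j v * R y \<partial>lborel))"
    using nn_integral_slice[of "\<lambda>y. F j (y $ j) * R y" "cbox 0 One" j] one by (simp add: R_upd)
  also have "\<dots> = ?I (\<lambda>y. (\<integral>\<^sup>+ v. F j v \<partial>lborel) * (indicator (cbox 0 One) (y $ j) * R y))"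
    by (subst nn_integral_multc) (auto simp: mult_ac)
  also have "\<dots> = (\<integral>\<^sup>+ v. F j v \<partial>lborel) * ?I (\<lambda>y. indicator (cbox 0 One) (y $ j) * R y)"
    by (rule nn_integral_cmult) measurable
  also have "?I (\<lambda>y. indicator (cbox 0 One) (y $ j) * R y) = (\<Prod>i\<in>S. \<integral>\<^sup>+ v. F i v \<partial>lborel)"
    unfolding insert.IH[symmetric] using insert.hyps
    by (intro nn_integral_cong, subst prod.remove[of UNIV j]) (auto simp: R_def)
  finally have "?I (\<lambda>y. F j (y $ j) * R y) =
      (\<integral>\<^sup>+ v. F j v \<partial>lborel) * (\<Prod>i\<in>S. \<integral>\<^sup>+ v. F i v \<partial>lborel)" .
  moreover have "(\<Prod>i\<in>UNIV. if i \<in> insert j S then F i (y $ i) else indicator (cbox 0 One) (y $ i)) =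
      F j (y $ j) * R y" for y
    unfolding R_def by (subst prod.remove[of UNIV j]) (auto intro!: prod.cong)
  ultimately show ?case
    using insert.hyps by simp
qed

lemma nn_integral_prod_vec:
  fixes F :: "'k::finite \<Rightarrow> 'a::euclidean_space \<Rightarrow> ennreal"
  assumes "\<And>i. F i \<in> borel_measurable borel"
  shows "(\<integral>\<^sup>+ y. (\<Prod>i\<in>UNIV. F i (y $ i)) \<partial>(lborel :: ('a ^ 'k) measure)) =
    (\<Prod>i\<in>UNIV. \<integral>\<^sup>+ v. F i v \<partial>lborel)"
  using nn_integral_prod_vec_aux[of F UNIV] assms by simp

section \<open>Norms in one variable\<close>

lemma ennreal_powr_ennreal: "0 \<le> a \<Longrightarrow> ennreal_powr (ennreal a) s = ennreal (a powr s)"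
  by (simp add: ennreal_powr_def)

lemma ennreal_powr_top [simp]: "ennreal_powr top s = top"
  by (simp add: ennreal_powr_def)

lemma ennreal_powr_0 [simp]: "ennreal_powr 0 s = 0"
  by (simp add: ennreal_powr_def)

lemma ennreal_powr_1 [simp]: "ennreal_powr 1 s = 1"
  by (simp add: ennreal_powr_def)

lemma ennreal_powr_one [simp]: "ennreal_powr a 1 = a"
  by (cases a) (auto simp: ennreal_powr_ennreal)

lemma ennreal_powr_mono:
  assumes "0 \<le> s" "a \<le> b"
  shows "ennreal_powr a s \<le> ennreal_powr b s"
  using assms by (cases a; cases b) (auto simp: ennreal_powr_ennreal top_unique intro!: powr_mono2)

lemma ennreal_powr_eq_0_iff [simp]: "ennreal_powr a s = 0 \<longleftrightarrow> a = 0"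
  by (cases a) (auto simp: ennreal_powr_ennreal)

lemma ennreal_powr_eq_top_iff [simp]: "ennreal_powr a s = top \<longleftrightarrow> a = top"
  by (cases a) (auto simp: ennreal_powr_ennreal)

lemma ennreal_powr_less_top_iff [simp]: "ennreal_powr a s < top \<longleftrightarrow> a < top"
  by (simp add: less_top[symmetric])

text \<open>Because \<open>0\<close> and \<open>top\<close> are fixed for every exponent, the
  identity also survives the convention \<open>0 * top = 0\<close>.\<close>

lemma ennreal_powr_mult: "ennreal_powr (a * b) s = ennreal_powr a s * ennreal_powr b s"
proof (cases a)
  case (real x)
  show ?thesis
  proof (cases b)
    case b: (real y)
    then show ?thesis
      using real by (simp add: ennreal_powr_ennreal powr_mult flip: ennreal_mult)
  next
    case top
    then show ?thesis
      using real by (cases "x = 0") (auto simp: ennreal_mult_top ennreal_powr_ennreal)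
  qed
next
  case top
  then show ?thesis
    by (cases "b = 0") (auto simp: ennreal_top_mult)
qed

lemma ennreal_powr_powr: "ennreal_powr (ennreal_powr a s) t = ennreal_powr a (s * t)"
  by (cases a) (auto simp: ennreal_powr_ennreal powr_powr)

lemma ennreal_powr_max:
  "0 \<le> s \<Longrightarrow> ennreal_powr (max a b) s = max (ennreal_powr a s) (ennreal_powr b s)"
  using ennreal_powr_mono[of s a b] ennreal_powr_mono[of s b a]
  by (cases "a \<le> b") (auto simp: max_absorb1 max_absorb2)

lemma measurable_ennreal_powr [measurable (raw)]:
  assumes [measurable]: "f \<in> borel_measurable M"
  shows "(\<lambda>x. ennreal_powr (f x) s) \<in> borel_measurable M"
  unfolding ennreal_powr_def by measurable

lemma tendsto_ennreal_powr_0: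
  assumes lim: "(f \<longlongrightarrow> 0) F" and s: "0 < s"
  shows "((\<lambda>x. ennreal_powr (f x) s) \<longlongrightarrow> 0) F"
proof -
  have fin: "eventually (\<lambda>x. f x < top) F"
    using order_tendstoD(2)[OF lim] by simp
  have "((\<lambda>x. enn2real (f x)) \<longlongrightarrow> 0) F"
    using tendsto_enn2real[of f 0 F] lim by simp
  then have "((\<lambda>x. enn2real (f x) powr s) \<longlongrightarrow> 0) F"
    using s by (intro tendsto_zero_powrI[of _ _ _ s]) (auto)
  then have "((\<lambda>x. ennreal (enn2real (f x) powr s)) \<longlongrightarrow> ennreal 0) F"
    by (rule tendsto_ennrealI)
  moreover have "eventually (\<lambda>x. ennreal_powr (f x) s = ennreal (enn2real (f x) powr s)) F"
    using fin by eventually_elim (auto simp: ennreal_powr_def)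
  ultimately show ?thesis
    by (simp add: tendsto_cong)
qed

text \<open>The nonnegative integral is a supremum over simple functions from below and does not
  change under completion, whatever \<open>g\<close> is. All later work can thus use
  \<open>lborel\<close>.\<close>

lemma Lp_norm_1_real:
  "0 < p \<Longrightarrow> Lp_norm_1 (ennreal p) g =
    ennreal_powr (\<integral>\<^sup>+ t. ennreal_powr (g t) p \<partial>lborel) (1 / p)"
  by (simp add: Lp_norm_1_def nn_integral_completion)

lemma Lp_norm_1_one: "Lp_norm_1 1 g = (\<integral>\<^sup>+ t. g t \<partial>lborel)"
  using Lp_norm_1_real[of 1 g] by simp

lemma Lp_norm_1_mono_AE:
  assumes "0 < p" "AE t in lborel. g t \<le> h t"
  shows "Lp_norm_1 (ennreal p) g \<le> Lp_norm_1 (ennreal p) h"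
  unfolding Lp_norm_1_real[OF assms(1)] using assms
  by (intro ennreal_powr_mono nn_integral_mono_AE) (auto elim!: eventually_mono intro: ennreal_powr_mono)

lemma Lp_norm_1_cmult:
  assumes "0 < p" and [measurable]: "g \<in> borel_measurable borel"
  shows "Lp_norm_1 (ennreal p) (\<lambda>t. c * g t) = c * Lp_norm_1 (ennreal p) g"
  using assms(1) by (simp add: Lp_norm_1_real ennreal_powr_mult nn_integral_cmult ennreal_powr_powr)

lemma Lp_norm_1_indicator:
  assumes "0 < p" and [measurable]: "I \<in> sets borel"
  shows "Lp_norm_1 (ennreal p) (indicator I) = ennreal_powr (emeasure lborel I) (1 / p)"
proof -
  have "ennreal_powr (indicator I t) p = indicator I t" for t
    by (simp add: indicator_def)
  then show ?thesis
    using assms(1) by (simp add: Lp_norm_1_real)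
qed

text \<open>Bounding a sum by twice the maximum is compatible with powers below and above one alike.
  Done pointwise it costs the factor 2, done once more for the two integrals it costs
  \<open>2 powr (1 / p)\<close>.\<close>

lemma Lp_norm_1_add:
  assumes p: "0 < p" and [measurable]: "g \<in> borel_measurable borel" "h \<in> borel_measurable borel"
  shows "Lp_norm_1 (ennreal p) (\<lambda>t. g t + h t) \<le>
    ennreal (2 * 2 powr (1 / p)) * (Lp_norm_1 (ennreal p) g + Lp_norm_1 (ennreal p) h)"
proof -
  let ?G = "\<integral>\<^sup>+ t. ennreal_powr (g t) p \<partial>lborel" and ?H = "\<integral>\<^sup>+ t. ennreal_powr (h t) p \<partial>lborel"
  have sum_max: "a + b \<le> 2 * max a b" for a b :: ennreal
    unfolding mult_2 by (intro add_mono) auto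
  have two: "ennreal_powr 2 s = ennreal (2 powr s)" for s
    using ennreal_powr_ennreal[of 2 s] by simp
  have "ennreal_powr (g t + h t) p \<le> ennreal_powr 2 p * (ennreal_powr (g t) p + ennreal_powr (h t) p)" for t
  proof -
    have "ennreal_powr (g t + h t) p \<le> ennreal_powr (2 * max (g t) (h t)) p"
      using p by (intro ennreal_powr_mono sum_max) simp
    also have "\<dots> = ennreal_powr 2 p * max (ennreal_powr (g t) p) (ennreal_powr (h t) p)"
      using p by (simp add: ennreal_powr_mult ennreal_powr_max)
    also have "\<dots> \<le> ennreal_powr 2 p * (ennreal_powr (g t) p + ennreal_powr (h t) p)"
      by (intro mult_left_mono max.boundedI) auto
    finally show ?thesis .
  qed
  then have "(\<integral>\<^sup>+ t. ennreal_powr (g t + h t) p \<partial>lborel) \<le>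
      (\<integral>\<^sup>+ t. ennreal_powr 2 p * (ennreal_powr (g t) p + ennreal_powr (h t) p) \<partial>lborel)"
    by (intro nn_integral_mono)
  also have "\<dots> = ennreal_powr 2 p * (?G + ?H)"
    by (simp add: nn_integral_cmult nn_integral_add)
  also have "\<dots> \<le> ennreal_powr 2 p * (2 * max ?G ?H)"
    by (intro mult_left_mono sum_max) simp
  finally have "Lp_norm_1 (ennreal p) (\<lambda>t. g t + h t) \<le>
      ennreal_powr (ennreal_powr 2 p * (2 * max ?G ?H)) (1 / p)"
    unfolding Lp_norm_1_real[OF p] using p by (intro ennreal_powr_mono) simp
  also have "\<dots> = ennreal (2 * 2 powr (1 / p)) * max (ennreal_powr ?G (1 / p)) (ennreal_powr ?H (1 / p))"
  proof -
    have "ennreal_powr (ennreal_powr 2 p) (1 / p) = 2"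
      using p by (simp add: ennreal_powr_powr)
    then show ?thesis
      using p by (simp add: ennreal_powr_mult ennreal_powr_max two[of "1 / p"] ennreal_mult mult.assoc)
  qed
  also have "\<dots> \<le> ennreal (2 * 2 powr (1 / p)) * (ennreal_powr ?G (1 / p) + ennreal_powr ?H (1 / p))"
    by (intro mult_left_mono max.boundedI) auto
  finally show ?thesis
    by (simp add: Lp_norm_1_real[OF p])
qed

section \<open>Finiteness and dominated convergence in one variable\<close>

lemma Lp_norm_1_finite_AE:
  assumes "0 < p" and [measurable]: "g \<in> borel_measurable borel"
    and "Lp_norm_1 (ennreal p) g < top"
  shows "AE t in lborel. g t < top"
proof -
  have "AE t in lborel. ennreal_powr (g t) p \<noteq> \<infinity>"
    using assms by (intro nn_integral_PInf_AE) (auto simp: Lp_norm_1_real)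
  then show ?thesis
    by (simp add: less_top)
qed

lemma Lp_norm_1_tendsto_0:
  assumes p: "0 < p" and [measurable]: "\<And>N. g N \<in> borel_measurable borel"
    and dec: "\<And>N t. g N t \<le> g 0 t"
    and fin: "Lp_norm_1 (ennreal p) (g 0) < top"
    and lim: "AE t in lborel. (\<lambda>N. g N t) \<longlonglongrightarrow> 0"
  shows "(\<lambda>N::nat. Lp_norm_1 (ennreal p) (g N)) \<longlonglongrightarrow> 0"
proof -
  have "(\<lambda>N. \<integral>\<^sup>+ t. ennreal_powr (g N t) p \<partial>lborel) \<longlonglongrightarrow> (\<integral>\<^sup>+ t. 0 \<partial>(lborel :: real measure))"
  proof (rule nn_integral_dominated_convergence)
    show "AE t in lborel. ennreal_powr (g N t) p \<le> ennreal_powr (g 0 t) p" for N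
      using p dec by (intro AE_I2 ennreal_powr_mono) auto
    show "(\<integral>\<^sup>+ t. ennreal_powr (g 0 t) p \<partial>lborel) < \<infinity>"
      using fin p by (simp add: Lp_norm_1_real)
    show "AE t in lborel. (\<lambda>N. ennreal_powr (g N t) p) \<longlonglongrightarrow> 0"
      using lim by eventually_elim (rule tendsto_ennreal_powr_0[OF _ p])
  qed auto
  then show ?thesis
    using p by (auto simp: Lp_norm_1_real intro!: tendsto_ennreal_powr_0)
qed

text \<open>Splitting at the level \<open>\<lambda> = \<parallel>g\<parallel>\<^sub>p \<bar>I\<bar>\<^sup>-\<^sup>1\<^sup>/\<^sup>p\<close> gives Hoelder's inequality up to
  a factor two.\<close>

lemma nn_integral_le_Lp_norm_1:
  assumes p: "1 \<le> p" and L: "0 < L" and [measurable]: "g \<in> borel_measurable borel" "I \<in> sets borel"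
    and I: "emeasure lborel I = ennreal L" and supp: "\<And>t. t \<notin> I \<Longrightarrow> g t = 0"
  shows "(\<integral>\<^sup>+ t. g t \<partial>lborel) \<le> ennreal (2 * L powr (1 - 1 / p)) * Lp_norm_1 (ennreal p) g"
proof -
  have p0: "0 < p" using p by simp
  define A where "A = Lp_norm_1 (ennreal p) g"
  have A_powr: "(\<integral>\<^sup>+ t. ennreal_powr (g t) p \<partial>lborel) = ennreal_powr A p"
    using p0 by (simp add: A_def Lp_norm_1_real ennreal_powr_powr)
  consider "A = top" | "A = 0" | a where "A = ennreal a" "0 < a"
    by (cases A) (auto simp: less_le)
  then show ?thesis
  proof cases
    case 1
    then show ?thesis
      using L by (simp add: A_def ennreal_mult_top)
  next
    case 2
    then have "AE t in lborel. ennreal_powr (g t) p = 0"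
      using A_powr by (subst nn_integral_0_iff_AE[symmetric]) auto
    then have "(\<integral>\<^sup>+ t. g t \<partial>lborel) = 0"
      by (subst nn_integral_0_iff_AE) auto
    then show ?thesis by simp
  next
    case (3 a)
    define l where "l = a * L powr (- 1 / p)"
    have l: "0 < l" using 3 L by (simp add: l_def)
    \<comment> \<open>Values up to \<open>l\<close> are charged to the indicator, larger ones to the
      p-th power: there \<open>b powr (1 - p)\<close> is at most \<open>l powr (1 - p)\<close>
      because the exponent is nonpositive.\<close>
    have le: "g t \<le> ennreal l * indicator I t + ennreal (l powr (1 - p)) * ennreal_powr (g t) p" for t
    proof (cases "g t")
      case top
      then show ?thesis using l by (simp add: ennreal_mult_top)
    next
      case (real b)
      show ?thesis
      proof (cases "b \<le> l")
        case True
        then show ?thesis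
          using real supp[of t] by (cases "t \<in> I") (auto intro: order_trans[OF ennreal_leI add_increasing2])
      next
        case False
        have "b = b powr (1 - p) * b powr p"
          using False l by (simp flip: powr_add)
        also have "\<dots> \<le> l powr (1 - p) * b powr p"
          using False l p by (intro mult_right_mono powr_mono2') auto
        finally have "ennreal b \<le> ennreal (l powr (1 - p)) * ennreal (b powr p)"
          by (simp flip: ennreal_mult add: ennreal_leI)
        then show ?thesis
          using real by (simp add: ennreal_powr_ennreal add_increasing)
      qed
    qed
    have "(\<integral>\<^sup>+ t. g t \<partial>lborel) \<le>
        (\<integral>\<^sup>+ t. ennreal l * indicator I t + ennreal (l powr (1 - p)) * ennreal_powr (g t) p \<partial>lborel)"
      by (intro nn_integral_mono le)
    also have "\<dots> = ennreal l * ennreal L + ennreal (l powr (1 - p)) * ennreal_powr A p"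
      by (simp add: nn_integral_add nn_integral_cmult I A_powr)
    also have "\<dots> = ennreal (l * L + l powr (1 - p) * a powr p)"
      using 3 l L by (simp add: ennreal_powr_ennreal flip: ennreal_mult ennreal_plus)
    \<comment> \<open>The level was chosen so that both terms have the same value.\<close>
    also have "l * L = a * L powr (1 - 1 / p)"
      using L by (simp add: l_def powr_diff powr_minus field_simps)
    also have "l powr (1 - p) * a powr p = a * L powr (1 - 1 / p)"
    proof -
      have "l powr (1 - p) * a powr p = (a powr (1 - p) * a powr p) * (L powr (- 1 / p)) powr (1 - p)"
        using 3 L by (simp add: l_def powr_mult)
      also have "a powr (1 - p) * a powr p = a"
        using 3 by (simp flip: powr_add)
      also have "(L powr (- 1 / p)) powr (1 - p) = L powr (1 - 1 / p)"
      proof -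
        have "- 1 / p * (1 - p) = 1 - 1 / p"
          using p0 by (simp add: field_simps)
        then show ?thesis by (simp add: powr_powr)
      qed
      finally show ?thesis .
    qed
    also have "ennreal (a * L powr (1 - 1 / p) + a * L powr (1 - 1 / p)) =
        ennreal (2 * L powr (1 - 1 / p)) * A"
      using 3 by (simp flip: ennreal_mult)
    finally show ?thesis by (simp add: A_def)
  qed
qed

section \<open>Iterated norms\<close>

abbreviation iter_norm ::
  "('n::finite \<Rightarrow> real) \<Rightarrow> 'n list \<Rightarrow> (real ^ 'n \<Rightarrow> ennreal) \<Rightarrow> real ^ 'n \<Rightarrow> ennreal" where
  "iter_norm p \<equiv> iterated_norm (\<lambda>j. ennreal (p j))"

lemma measurable_slice_Lp_norm_1 [measurable]:
  fixes F :: "real ^ 'n::finite \<Rightarrow> ennreal"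
  assumes p: "0 < p" and [measurable]: "F \<in> borel_measurable borel"
  shows "(\<lambda>x. Lp_norm_1 (ennreal p) (\<lambda>t. F (coord_upd x j t))) \<in> borel_measurable borel"
  unfolding Lp_norm_1_real[OF p] coord_upd_eq_vec_upd by measurable

lemma measurable_slice:
  fixes F :: "real ^ 'n::finite \<Rightarrow> ennreal"
  assumes [measurable]: "F \<in> borel_measurable borel"
  shows "(\<lambda>t. F (coord_upd x j t)) \<in> borel_measurable borel"
  unfolding coord_upd_eq_vec_upd by measurable

text \<open>A null set has null slices through almost every point, so the comparison survives each
  further norm. This is what permits the exchange of Lebesgue measurable functions for Borel
  ones.\<close>

lemma iter_norm_mono_AE:
  assumes "\<And>j. 0 < p j" and "AE x in lborel. F x \<le> G x"
  shows "AE x in lborel. iter_norm p js F x \<le> iter_norm p js G x"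
  using assms(2)
proof (induction js arbitrary: F G)
  case (Cons j js)
  have "AE x in lborel. AE t in lborel. F (coord_upd x j t) \<le> G (coord_upd x j t)"
    unfolding coord_upd_eq_vec_upd by (rule AE_sliceI[OF Cons.prems])
  then have "AE x in lborel. Lp_norm_1 (ennreal (p j)) (\<lambda>t. F (coord_upd x j t)) \<le>
      Lp_norm_1 (ennreal (p j)) (\<lambda>t. G (coord_upd x j t))"
    by eventually_elim (intro Lp_norm_1_mono_AE assms(1))
  then show ?case
    unfolding iterated_norm.simps by (rule Cons.IH)
qed simp

lemma iter_norm_mono:
  assumes "\<And>j. 0 < p j" and "\<And>x. F x \<le> G x"
  shows "iter_norm p js F x \<le> iter_norm p js G x"
  using assms(2)
proof (induction js arbitrary: F G)
  case (Cons j js)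
  then show ?case
    unfolding iterated_norm.simps by (intro Cons.IH Lp_norm_1_mono_AE assms(1)) auto
qed simp

lemma iter_norm_cmult:
  assumes "\<And>j. 0 < p j" and "F \<in> borel_measurable borel"
  shows "iter_norm p js (\<lambda>x. c * F x) x = c * iter_norm p js F x"
  using assms(2)
proof (induction js arbitrary: F)
  case (Cons j js)
  have "Lp_norm_1 (ennreal (p j)) (\<lambda>t. c * F (coord_upd x j t)) =
      c * Lp_norm_1 (ennreal (p j)) (\<lambda>t. F (coord_upd x j t))" for x
    by (intro Lp_norm_1_cmult assms(1) measurable_slice Cons.prems)
  then show ?case
    using Cons.IH[OF measurable_slice_Lp_norm_1[OF assms(1) Cons.prems]] by simp
qed simp

text \<open>The estimate for the innermost variable holds pointwise and passes through the outer
  norms by monotonicity and homogeneity; the constants of the single variables multiply.\<close>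

lemma iter_norm_add:
  assumes p: "\<And>j. 0 < p j"
  shows "\<exists>K::real. \<forall>F\<in>borel_measurable borel. \<forall>G\<in>borel_measurable borel. \<forall>x.
    iter_norm p js (\<lambda>x. F x + G x) x \<le> ennreal K * (iter_norm p js F x + iter_norm p js G x)"
proof (induction js)
  case Nil
  show ?case by (intro exI[of _ 1]) simp
next
  case (Cons j js)
  then obtain K where K: "\<And>F G x. F \<in> borel_measurable borel \<Longrightarrow> G \<in> borel_measurable borel \<Longrightarrow>
      iter_norm p js (\<lambda>x. F x + G x) x \<le> ennreal K * (iter_norm p js F x + iter_norm p js G x)"
    by blast
  define c where "c = 2 * 2 powr (1 / p j)"
  show ?case
  proof (intro exI[of _ "c * K"] ballI allI)
    fix F G :: "real ^ 'a \<Rightarrow> ennreal" and x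
    assume FG [measurable]: "F \<in> borel_measurable borel" "G \<in> borel_measurable borel"
    define F' where "F' x = Lp_norm_1 (ennreal (p j)) (\<lambda>t. F (coord_upd x j t))" for x
    define G' where "G' x = Lp_norm_1 (ennreal (p j)) (\<lambda>t. G (coord_upd x j t))" for x
    have meas: "F' \<in> borel_measurable borel" "G' \<in> borel_measurable borel"
      unfolding F'_def G'_def by (auto intro: measurable_slice_Lp_norm_1 p FG)
    then have meas': "(\<lambda>x. F' x + G' x) \<in> borel_measurable borel" by measurable
    have "iter_norm p (j # js) (\<lambda>x. F x + G x) x \<le> iter_norm p js (\<lambda>x. ennreal c * (F' x + G' x)) x"
      unfolding iterated_norm.simps F'_def G'_def c_def
      by (intro iter_norm_mono p Lp_norm_1_add measurable_slice FG)
    also have "\<dots> = ennreal c * iter_norm p js (\<lambda>x. F' x + G' x) x"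
      by (rule iter_norm_cmult[OF p meas'])
    also have "\<dots> \<le> ennreal c * (ennreal K * (iter_norm p js F' x + iter_norm p js G' x))"
      by (intro mult_left_mono K meas) simp
    finally show "iter_norm p (j # js) (\<lambda>x. F x + G x) x \<le>
        ennreal (c * K) * (iter_norm p (j # js) F x + iter_norm p (j # js) G x)"
      by (simp add: F'_def[abs_def] G'_def[abs_def] c_def ennreal_mult' mult.assoc)
  qed
qed

section \<open>Finiteness and dominated convergence for iterated norms\<close>

lemma AE_coord_sliceD:
  fixes P :: "real ^ 'n::finite \<Rightarrow> bool"
  assumes "AE x in lborel. AE t in lborel. P (coord_upd x j t)" and "Measurable.pred borel P"
  shows "AE x in lborel. P x"
  using AE_sliceD[OF assms[unfolded coord_upd_eq_vec_upd]] .

text \<open>Finiteness is known for the outermost norm but is needed on inner slices for dominated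
  convergence; the induction passes it inwards, variable by variable.\<close>

lemma iter_norm_finite_AE:
  assumes p: "\<And>j. 0 < p j" and F: "F \<in> borel_measurable borel"
    and "AE x in lborel. iter_norm p js F x < top"
  shows "AE x in lborel. F x < top"
  using F assms(3)
proof (induction js arbitrary: F)
  case (Cons j js)
  note [measurable] = Cons.prems(1)
  have "AE x in lborel. Lp_norm_1 (ennreal (p j)) (\<lambda>t. F (coord_upd x j t)) < top"
    by (rule Cons.IH) (use Cons.prems in \<open>auto intro: measurable_slice_Lp_norm_1 p\<close>)
  then have "AE x in lborel. AE t in lborel. F (coord_upd x j t) < top"
    by eventually_elim (auto intro: Lp_norm_1_finite_AE[OF p measurable_slice[OF Cons.prems(1)]])
  then show ?case
    by (rule AE_coord_sliceD) measurable
qed simp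

text \<open>Dominated convergence is applied to one variable at a time, with the norm of
  \<open>F 0\<close> as majorant at every stage.\<close>

lemma iter_norm_tendsto_0:
  assumes p: "\<And>j. 0 < p j" and F: "\<And>N. F N \<in> borel_measurable borel"
    and dec: "\<And>N x. F N x \<le> F 0 x"
    and fin: "AE x in lborel. iter_norm p js (F 0) x < top"
    and lim: "AE x in lborel. (\<lambda>N::nat. F N x) \<longlonglongrightarrow> 0"
  shows "AE x in lborel. (\<lambda>N. iter_norm p js (F N) x) \<longlonglongrightarrow> 0"
  using F dec fin lim
proof (induction js arbitrary: F)
  case (Cons j js)
  let ?G = "\<lambda>N x. Lp_norm_1 (ennreal (p j)) (\<lambda>t. F N (coord_upd x j t))"
  have fin: "AE x in lborel. ?G 0 x < top"
    by (rule iter_norm_finite_AE[OF p])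
       (use Cons.prems(3) in \<open>auto intro: measurable_slice_Lp_norm_1 p Cons.prems(1)\<close>)
  have "AE x in lborel. AE t in lborel. (\<lambda>N. F N (coord_upd x j t)) \<longlonglongrightarrow> 0"
    unfolding coord_upd_eq_vec_upd by (rule AE_sliceI[OF Cons.prems(4)])
  with fin have "AE x in lborel. (\<lambda>N. ?G N x) \<longlonglongrightarrow> 0"
    by eventually_elim (intro Lp_norm_1_tendsto_0 p measurable_slice Cons.prems)
  note lim' = this
  show ?case
    unfolding iterated_norm.simps
  proof (rule Cons.IH[of ?G, OF _ _ _ lim'])
    show "?G N x \<le> ?G 0 x" for N x
      using Cons.prems(2) by (intro Lp_norm_1_mono_AE p) auto
  qed (use Cons.prems(3) in \<open>auto intro: measurable_slice_Lp_norm_1 p Cons.prems(1)\<close>)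
qed simp

text \<open>\<open>D\<close> holds the coordinates on which the function may still depend, and each
  norm removes one. Once all coordinates are listed the value is constant, so that almost-everywhere
  statements about it become statements about a number.\<close>

lemma iter_norm_depends:
  assumes "\<And>x y. (\<And>k. k \<in> D \<Longrightarrow> x $ k = y $ k) \<Longrightarrow> F x = F y"
    and "\<And>k. k \<in> D - set js \<Longrightarrow> x $ k = y $ k"
  shows "iterated_norm p js F x = iterated_norm p js F y"
  using assms
proof (induction js arbitrary: F D)
  case (Cons j js)
  show ?case
    unfolding iterated_norm.simps
  proof (rule Cons.IH[of "D - {j}"])
    fix x y :: "(real, 'a) vec" assume "\<And>k. k \<in> D - {j} \<Longrightarrow> x $ k = y $ k"
    then have "F (coord_upd x j t) = F (coord_upd y j t)" for t
      by (intro Cons.prems(1)) (auto simp: coord_upd_def)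
    then show "Lp_norm_1 (p j) (\<lambda>t. F (coord_upd x j t)) = Lp_norm_1 (p j) (\<lambda>t. F (coord_upd y j t))"
      by simp
  qed (use Cons.prems(2) in auto)
next
  case Nil
  then show ?case
    by (metis Diff_empty iterated_norm.simps(1) set_empty)
qed

text \<open>A tensor product has the product of the one-dimensional norms as its norm;
  \<open>S\<close> records the coordinates whose factor is still present.\<close>

lemma iter_norm_indicator_prod:
  assumes p: "\<And>j. 0 < p j" and I [measurable]: "\<And>k. I k \<in> sets borel"
    and "distinct js" "set js \<subseteq> S"
  shows "iter_norm p js (\<lambda>x. \<Prod>k\<in>S. indicator (I k) (x $ k)) x =
    (\<Prod>j\<in>set js. ennreal_powr (emeasure lborel (I j)) (1 / p j)) *
    (\<Prod>k\<in>S - set js. indicator (I k) (x $ k))"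
  using assms(3,4)
proof (induction js arbitrary: S)
  case (Cons j js)
  let ?c = "\<lambda>j. ennreal_powr (emeasure lborel (I j)) (1 / p j)"
  have j: "j \<in> S" "finite S" using Cons.prems by (auto intro: finite_subset[of _ UNIV])
  have "Lp_norm_1 (ennreal (p j)) (\<lambda>t. \<Prod>k\<in>S. indicator (I k) (coord_upd x j t $ k)) =
      ?c j * (\<Prod>k\<in>S - {j}. indicator (I k) (x $ k))" for x :: "real ^ 'a"
  proof -
    have "(\<Prod>k\<in>S. indicator (I k) (coord_upd x j t $ k)) =
        (\<Prod>k\<in>S - {j}. indicator (I k) (x $ k)) * (indicator (I j) t :: ennreal)" for t
      using j by (subst prod.remove[of S j]) (auto simp: coord_upd_def mult.commute intro!: prod.cong)
    then show ?thesis
      using Lp_norm_1_cmult[OF p, of "indicator (I j)" j] Lp_norm_1_indicator[OF p I, of j j]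
      by (simp add: mult.commute[of "ennreal_powr _ _"])
  qed
  then have "iter_norm p (j # js) (\<lambda>x. \<Prod>k\<in>S. indicator (I k) (x $ k)) x =
      iter_norm p js (\<lambda>x. ?c j * (\<Prod>k\<in>S - {j}. indicator (I k) (x $ k))) x"
    by simp
  also have "\<dots> = ?c j * iter_norm p js (\<lambda>x. \<Prod>k\<in>S - {j}. indicator (I k) (x $ k)) x"
    by (rule iter_norm_cmult[OF p]) measurable
  also have "\<dots> = ?c j * ((\<Prod>i\<in>set js. ?c i) * (\<Prod>k\<in>S - {j} - set js. indicator (I k) (x $ k)))"
    using Cons.prems by (subst Cons.IH) auto
  also have "\<dots> = (\<Prod>i\<in>set (j # js). ?c i) * (\<Prod>k\<in>S - set (j # js). indicator (I k) (x $ k))"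
  proof -
    have "S - {j} - set js = S - set (j # js)" by auto
    then show ?thesis
      using Cons.prems by (simp add: mult.assoc)
  qed
  finally show ?case .
qed simp

text \<open>A coordinate that has been integrated out no longer occurs in the iterated norm; a unit
  interval takes its place, so that both sides remain integrals over the whole space.\<close>

lemma iter_norm_one_aux:
  fixes F :: "real ^ 'n::finite \<Rightarrow> ennreal"
  assumes F: "F \<in> borel_measurable borel" and "distinct js"
  shows "(\<integral>\<^sup>+ x. F x * (\<Prod>k\<in>UNIV - set js. indicator {0..1} (x $ k)) \<partial>lborel) =
    (\<integral>\<^sup>+ x. iter_norm (\<lambda>_. 1) js F x * (\<Prod>k\<in>UNIV. indicator {0..1} (x $ k)) \<partial>lborel)"
  using assms
proof (induction js arbitrary: F)
  case (Cons j js)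
  note [measurable] = Cons.prems(1)
  define G where "G x = Lp_norm_1 1 (\<lambda>t. F (coord_upd x j t))" for x
  have [measurable]: "G \<in> borel_measurable borel"
    unfolding G_def using measurable_slice_Lp_norm_1[of 1 F j] by simp
  let ?R = "\<lambda>x :: real ^ 'n. \<Prod>k\<in>UNIV - set (j # js). indicator {0..1} (x $ k) :: ennreal"
  have R: "?R (vec_upd x j t) = ?R x" for x t
    by (rule prod.cong) auto
  have "(\<integral>\<^sup>+ x. F x * ?R x \<partial>lborel) =
      (\<integral>\<^sup>+ x. indicator {0..1} (x $ j) *
        (\<integral>\<^sup>+ t. F (vec_upd x j t) * ?R (vec_upd x j t) \<partial>lborel) \<partial>lborel)"
    by (subst nn_integral_slice) (auto simp del: vec_upd_nth)
  also have "\<dots> = (\<integral>\<^sup>+ x. G x * (indicator {0..1} (x $ j) * ?R x) \<partial>lborel)"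
    unfolding R
    by (subst nn_integral_multc) (auto simp: G_def Lp_norm_1_one coord_upd_eq_vec_upd mult_ac)
  also have "\<dots> = (\<integral>\<^sup>+ x. G x * (\<Prod>k\<in>UNIV - set js. indicator {0..1} (x $ k)) \<partial>lborel)"
  proof -
    have "UNIV - set js - {j} = UNIV - set (j # js)" by auto
    then show ?thesis
      using Cons.prems by (subst prod.remove[of "UNIV - set js" j]) auto
  qed
  also have "\<dots> = (\<integral>\<^sup>+ x. iter_norm (\<lambda>_. 1) js G x * (\<Prod>k\<in>UNIV. indicator {0..1} (x $ k)) \<partial>lborel)"
    using Cons.prems by (intro Cons.IH) auto
  finally show ?case
    by (simp add: G_def[abs_def])
qed simp

text \<open>Tonelli's theorem phrased with all exponents equal to one, so that Hoelder's inequality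
  becomes a comparison of two iterated norms.\<close>

lemma nn_integral_eq_iter_norm_one:
  fixes F :: "real ^ 'n::finite \<Rightarrow> ennreal"
  assumes F: "F \<in> borel_measurable borel" and js: "distinct js" "set js = UNIV"
  shows "(\<integral>\<^sup>+ x. F x \<partial>lborel) = iter_norm (\<lambda>_. 1) js F 0"
proof -
  have const: "iter_norm (\<lambda>_. 1) js F x = iter_norm (\<lambda>_. 1) js F 0" for x
    by (rule iter_norm_depends[where D = UNIV]) (use js(2) in \<open>auto intro: arg_cong[of _ _ F] iffD2[OF vec_eq_iff]\<close>)
  have "(\<integral>\<^sup>+ x. (\<Prod>k\<in>UNIV. indicator {0..1} (x $ k)) \<partial>(lborel :: (real ^ 'n) measure)) = 1"
    by (subst nn_integral_prod_vec) auto
  then show ?thesis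
    using iter_norm_one_aux[OF F js(1)] js(2)
    by (subst (asm) const) (simp add: nn_integral_cmult)
qed

text \<open>The one-dimensional inequality is applied coordinate by coordinate. A box suits this:
  every slice lives on an interval of length \<open>L\<close>, and an inner norm still vanishes off
  the box in the remaining coordinates.\<close>

lemma iter_norm_Holder:
  assumes p: "\<And>j. 1 \<le> p j" and L: "0 < L" and [measurable]: "\<And>k. I k \<in> sets borel"
    and I: "\<And>k. emeasure lborel (I k) = ennreal L"
    and "F \<in> borel_measurable borel" and "\<And>x j. j \<in> set js \<Longrightarrow> x $ j \<notin> I j \<Longrightarrow> F x = 0"
    and "distinct js"
  shows "iter_norm (\<lambda>_. 1) js F x \<le>
    ennreal (\<Prod>j\<in>set js. 2 * L powr (1 - 1 / p j)) * iter_norm p js F x"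
  using assms(5-)
proof (induction js arbitrary: F)
  case (Cons j js)
  have p0: "0 < p j" for j using p[of j] by simp
  let ?c = "\<lambda>j. 2 * L powr (1 - 1 / p j)"
  define G where "G x = Lp_norm_1 (ennreal (p j)) (\<lambda>t. F (coord_upd x j t))" for x
  have G: "G \<in> borel_measurable borel"
    unfolding G_def by (intro measurable_slice_Lp_norm_1 p0 Cons.prems)
  have "iter_norm (\<lambda>_. 1) (j # js) F x \<le> iter_norm (\<lambda>_. 1) js (\<lambda>x. ennreal (?c j) * G x) x"
    unfolding iterated_norm.simps G_def ennreal_1 Lp_norm_1_one
  proof (intro iter_norm_mono[where p = "\<lambda>_. 1", unfolded ennreal_1] nn_integral_le_Lp_norm_1[where I = "I j"])
    show "F (coord_upd x j t) = 0" if "t \<notin> I j" for x t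
      using that by (intro Cons.prems(2)[of j]) (auto simp: coord_upd_def)
  qed (auto intro!: p L I measurable_slice Cons.prems)
  also have "\<dots> = ennreal (?c j) * iter_norm (\<lambda>_. 1) js G x"
    by (rule iter_norm_cmult[OF _ G]) simp
  also have "\<dots> \<le> ennreal (?c j) * (ennreal (\<Prod>j\<in>set js. ?c j) * iter_norm p js G x)"
  proof (intro mult_left_mono Cons.IH G)
    fix x k assume k: "k \<in> set js" "x $ k \<notin> I k"
    then have "F (coord_upd x j t) = 0" for t
      using Cons.prems(3) by (intro Cons.prems(2)[of k]) (auto simp: coord_upd_def)
    then show "G x = 0"
      by (simp add: G_def Lp_norm_1_real[OF p0])
  qed (use Cons.prems in auto)
  also have "\<dots> = ennreal (\<Prod>j\<in>set (j # js). ?c j) * iter_norm p (j # js) F x"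
    using Cons.prems(3)
    by (simp add: G_def[abs_def] ennreal_mult' mult.assoc)
  finally show ?case .
qed simp

section \<open>Mixed norms\<close>

text \<open>The majorants of the proof may take the value \<open>top\<close> and are not moduli of
  complex functions, hence a norm for extended nonnegative functions.\<close>

definition mixed_ennorm ::
  "('n::{finite,linorder} \<Rightarrow> real) \<Rightarrow> (real ^ 'n::{finite,linorder} \<Rightarrow> ennreal) \<Rightarrow> ennreal" where
  "mixed_ennorm p F = iter_norm p (sorted_list_of_set UNIV) F 0"

lemma mixed_norm_eq_mixed_ennorm:
  "mixed_norm (\<lambda>j. ennreal (p j)) f = mixed_ennorm p (\<lambda>x. ennreal (cmod (f x)))"
  by (simp add: mixed_norm_def mixed_ennorm_def)

lemma iter_norm_eq_mixed_ennorm: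
  "iter_norm p (sorted_list_of_set UNIV) F x = mixed_ennorm p F"
  unfolding mixed_ennorm_def
  by (rule iter_norm_depends[where D = UNIV]) (auto intro: arg_cong[of _ _ F] iffD2[OF vec_eq_iff])

lemma lebesgue_ex_borel_AE:
  fixes F :: "'a::euclidean_space \<Rightarrow> ennreal"
  assumes "F \<in> borel_measurable lebesgue"
  obtains G where "G \<in> borel_measurable borel" "AE x in lborel. F x = G x"
  using completion_ex_borel_measurable[OF assms] by auto

context
  fixes p :: "'n::{finite,linorder} \<Rightarrow> real"
  assumes p: "\<And>j. 0 < p j"
begin

lemma mixed_ennorm_mono_AE:
  assumes "AE x in lborel. F x \<le> G x"
  shows "mixed_ennorm p F \<le> mixed_ennorm p G"
proof -
  \<comment> \<open>Neither side depends on \<open>x\<close>, and the whole space is not a null set,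
    so holding almost everywhere means holding.\<close>
  have "AE x :: (real, 'n) vec in lborel. mixed_ennorm p F \<le> mixed_ennorm p G"
    using iter_norm_mono_AE[of p F G "sorted_list_of_set UNIV"] p assms
    by (simp add: iter_norm_eq_mixed_ennorm)
  then show ?thesis
    by (simp add: eventually_const ae_filter_eq_bot_iff emeasure_lborel_UNIV)
qed

lemma mixed_ennorm_cong_AE:
  "AE x in lborel. F x = G x \<Longrightarrow> mixed_ennorm p F = mixed_ennorm p G"
  by (intro antisym mixed_ennorm_mono_AE) (auto elim: eventually_mono)

lemma mixed_ennorm_mono:
  "(\<And>x. F x \<le> G x) \<Longrightarrow> mixed_ennorm p F \<le> mixed_ennorm p G"
  by (intro mixed_ennorm_mono_AE) auto

lemma mixed_ennorm_cmult:
  assumes "F \<in> borel_measurable lebesgue"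
  shows "mixed_ennorm p (\<lambda>x. c * F x) = c * mixed_ennorm p F"
proof -
  obtain G where G: "G \<in> borel_measurable borel" "AE x in lborel. F x = G x"
    using lebesgue_ex_borel_AE[OF assms] .
  have "mixed_ennorm p (\<lambda>x. c * F x) = mixed_ennorm p (\<lambda>x. c * G x)"
    using G(2) by (intro mixed_ennorm_cong_AE) (auto elim: eventually_mono)
  also have "\<dots> = c * mixed_ennorm p G"
    unfolding mixed_ennorm_def by (rule iter_norm_cmult[OF p G(1)])
  also have "mixed_ennorm p G = mixed_ennorm p F"
    using G(2) by (intro mixed_ennorm_cong_AE) (auto elim: eventually_mono)
  finally show ?thesis .
qed

lemma mixed_ennorm_0 [simp]: "mixed_ennorm p (\<lambda>_. 0) = 0"
  using mixed_ennorm_cmult[of "\<lambda>_. 0" 0] by simp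

lemma mixed_ennorm_add:
  "\<exists>K::real. 0 \<le> K \<and> (\<forall>F\<in>borel_measurable lebesgue. \<forall>G\<in>borel_measurable lebesgue.
    mixed_ennorm p (\<lambda>x. F x + G x) \<le> ennreal K * (mixed_ennorm p F + mixed_ennorm p G))"
proof -
  obtain K where K: "\<And>F G x. F \<in> borel_measurable borel \<Longrightarrow> G \<in> borel_measurable borel \<Longrightarrow>
      iter_norm p (sorted_list_of_set UNIV) (\<lambda>x. F x + G x) x \<le>
      ennreal K * (iter_norm p (sorted_list_of_set UNIV) F x + iter_norm p (sorted_list_of_set UNIV) G x)"
    using iter_norm_add[of p, OF p] by blast
  have "mixed_ennorm p (\<lambda>x. F x + G x) \<le> ennreal K * (mixed_ennorm p F + mixed_ennorm p G)"
    if F: "F \<in> borel_measurable lebesgue" and G: "G \<in> borel_measurable lebesgue" for F G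
  proof -
    obtain F' where F': "F' \<in> borel_measurable borel" "AE x in lborel. F x = F' x"
      using lebesgue_ex_borel_AE[OF F] .
    obtain G' where G': "G' \<in> borel_measurable borel" "AE x in lborel. G x = G' x"
      using lebesgue_ex_borel_AE[OF G] .
    have "mixed_ennorm p (\<lambda>x. F x + G x) = mixed_ennorm p (\<lambda>x. F' x + G' x)"
      using F'(2) G'(2) by (intro mixed_ennorm_cong_AE) auto
    also have "\<dots> \<le> ennreal K * (mixed_ennorm p F' + mixed_ennorm p G')"
      unfolding mixed_ennorm_def by (rule K[OF F'(1) G'(1)])
    also have "mixed_ennorm p F' = mixed_ennorm p F"
      using F'(2) by (auto intro!: mixed_ennorm_cong_AE elim: eventually_mono)
    also have "mixed_ennorm p G' = mixed_ennorm p G"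
      using G'(2) by (auto intro!: mixed_ennorm_cong_AE elim: eventually_mono)
    finally show ?thesis .
  qed
  \<comment> \<open>\<open>ennreal\<close> sends negative reals to zero, so the nonnegative part of
    \<open>K\<close> is the same constant.\<close>
  moreover have "ennreal (max K 0) = ennreal K"
    by (simp add: max_def ennreal_neg)
  ultimately show ?thesis
    by (intro exI[of _ "max K 0"]) auto
qed

lemma mixed_ennorm_sum:
  assumes "finite S"
  shows "\<exists>K::real. 0 \<le> K \<and> (\<forall>F. (\<forall>a\<in>S. F a \<in> borel_measurable lebesgue) \<longrightarrow>
    mixed_ennorm p (\<lambda>x. \<Sum>a\<in>S. F a x) \<le> ennreal K * (\<Sum>a\<in>S. mixed_ennorm p (F a)))"
  using assms
proof (induction S rule: finite_induct)
  case empty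
  show ?case by (intro exI[of _ 0]) simp
next
  case (insert b S)
  obtain K where K: "0 \<le> K" "\<And>F. (\<forall>a\<in>S. F a \<in> borel_measurable lebesgue) \<Longrightarrow>
      mixed_ennorm p (\<lambda>x. \<Sum>a\<in>S. F a x) \<le> ennreal K * (\<Sum>a\<in>S. mixed_ennorm p (F a))"
    using insert.IH by blast
  obtain K' where K': "0 \<le> K'" "\<And>F G. F \<in> borel_measurable lebesgue \<Longrightarrow> G \<in> borel_measurable lebesgue \<Longrightarrow>
      mixed_ennorm p (\<lambda>x. F x + G x) \<le> ennreal K' * (mixed_ennorm p F + mixed_ennorm p G)"
    using mixed_ennorm_add by blast
  \<comment> \<open>The maximum with 1 lets the new summand, which has coefficient one, share a
    constant with the old ones.\<close>
  have "mixed_ennorm p (\<lambda>x. \<Sum>a\<in>insert b S. F a x) \<le>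
      ennreal (K' * max 1 K) * (\<Sum>a\<in>insert b S. mixed_ennorm p (F a))"
    if F: "\<forall>a\<in>insert b S. F a \<in> borel_measurable lebesgue" for F
  proof -
    have "mixed_ennorm p (\<lambda>x. \<Sum>a\<in>insert b S. F a x) = mixed_ennorm p (\<lambda>x. F b x + (\<Sum>a\<in>S. F a x))"
      using insert.hyps by simp
    also have "\<dots> \<le> ennreal K' * (mixed_ennorm p (F b) + mixed_ennorm p (\<lambda>x. \<Sum>a\<in>S. F a x))"
      using F by (intro K' borel_measurable_sum) auto
    also have "\<dots> \<le> ennreal K' * (ennreal (max 1 K) * mixed_ennorm p (F b) +
        ennreal (max 1 K) * (\<Sum>a\<in>S. mixed_ennorm p (F a)))"
    proof (intro mult_left_mono add_mono)
      show "mixed_ennorm p (F b) \<le> ennreal (max 1 K) * mixed_ennorm p (F b)"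
        using mult_right_mono[of 1 "ennreal (max 1 K)" "mixed_ennorm p (F b)"] by (simp add: ennreal_ge_1)
      show "mixed_ennorm p (\<lambda>x. \<Sum>a\<in>S. F a x) \<le> ennreal (max 1 K) * (\<Sum>a\<in>S. mixed_ennorm p (F a))"
        using F by (intro order_trans[OF K(2)] mult_right_mono ennreal_leI) auto
    qed auto
    also have "\<dots> = ennreal (K' * max 1 K) * (\<Sum>a\<in>insert b S. mixed_ennorm p (F a))"
      using insert.hyps K'(1) by (simp add: ennreal_mult distrib_left mult.assoc)
    finally show ?thesis .
  qed
  then show ?case
    using K'(1) K(1) by (intro exI[of _ "K' * max 1 K"]) auto
qed

lemma mixed_ennorm_tail_tendsto_0:
  assumes F: "F \<in> borel_measurable lebesgue" and fin: "mixed_ennorm p F < top"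
  shows "(\<lambda>N. mixed_ennorm p (\<lambda>x. F x * indicator (- ball 0 (real N)) x)) \<longlonglongrightarrow> 0"
proof -
  obtain G where G [measurable]: "G \<in> borel_measurable borel" and FG: "AE x in lborel. F x = G x"
    using lebesgue_ex_borel_AE[OF F] .
  let ?G = "\<lambda>N x. G x * indicator (- ball 0 (real N)) x"
  have "AE x :: (real, 'n) vec in lborel. (\<lambda>N. iter_norm p (sorted_list_of_set UNIV) (?G N) x) \<longlonglongrightarrow> 0"
  proof (rule iter_norm_tendsto_0[OF p])
    show "?G N x \<le> ?G 0 x" for N x
      by (simp add: indicator_def)
    \<comment> \<open>The ball of radius zero is empty, so \<open>?G 0\<close> is \<open>G\<close>
      itself, the dominating function.\<close>
    have "mixed_ennorm p (?G 0) = mixed_ennorm p F"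
      using FG by (intro mixed_ennorm_cong_AE) (auto elim: eventually_mono)
    then show "AE x in lborel. iter_norm p (sorted_list_of_set UNIV) (?G 0) x < top"
      using fin by (simp add: iter_norm_eq_mixed_ennorm)
    have "(\<lambda>N. ?G N x) \<longlonglongrightarrow> 0" for x
    proof (rule tendsto_eventually)
      obtain N0 :: nat where "norm x < real N0" using reals_Archimedean2 by blast
      then show "eventually (\<lambda>N. ?G N x = 0) sequentially"
        by (intro eventually_sequentiallyI[of N0]) (auto simp: indicator_def)
    qed
    then show "AE x in lborel. (\<lambda>N. ?G N x) \<longlonglongrightarrow> 0" by simp
  qed measurable
  then have "(\<lambda>N. mixed_ennorm p (?G N)) \<longlonglongrightarrow> 0"
    by (simp add: iter_norm_eq_mixed_ennorm eventually_const ae_filter_eq_bot_iff emeasure_lborel_UNIV)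
  moreover have "mixed_ennorm p (?G N) = mixed_ennorm p (\<lambda>x. F x * indicator (- ball 0 (real N)) x)" for N
    using FG by (intro mixed_ennorm_cong_AE) (auto elim: eventually_mono)
  ultimately show ?thesis by simp
qed

text \<open>Cubes are products of intervals, so their norm is explicit; balls are then enclosed
  between cubes.\<close>

lemma mixed_ennorm_cube:
  assumes s: "0 < s"
  shows "mixed_ennorm p (indicator {y. \<forall>j. \<bar>y $ j - x $ j\<bar> \<le> s}) =
    ennreal ((2 * s) powr (\<Sum>j\<in>UNIV. 1 / p j))"
proof -
  have ind: "indicator {y. \<forall>j. \<bar>y $ j - x $ j\<bar> \<le> s} =
      (\<lambda>y. \<Prod>j\<in>UNIV. indicator {x $ j - s .. x $ j + s} (y $ j) :: ennreal)"
    by (auto simp: fun_eq_iff indicator_def abs_le_iff algebra_simps)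
  have "mixed_ennorm p (indicator {y. \<forall>j. \<bar>y $ j - x $ j\<bar> \<le> s}) =
      (\<Prod>j\<in>UNIV. ennreal_powr (ennreal (2 * s)) (1 / p j))"
    unfolding mixed_ennorm_def ind using s
    by (subst iter_norm_indicator_prod[OF p]) auto
  also have "\<dots> = ennreal (\<Prod>j\<in>UNIV. (2 * s) powr (1 / p j))"
    using s by (simp add: ennreal_powr_ennreal prod_ennreal)
  also have "(\<Prod>j\<in>UNIV. (2 * s) powr (1 / p j)) = (2 * s) powr (\<Sum>j\<in>UNIV. 1 / p j)"
    using s by (simp add: powr_sum)
  finally show ?thesis .
qed

section \<open>Comparison of balls with cubes\<close>

lemma ball_subset_cube: "ball x s \<subseteq> {y :: (real, 'n) vec. \<forall>j. \<bar>y $ j - x $ j\<bar> \<le> s}"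
proof safe
  fix y j assume "y \<in> ball x s"
  then have "norm (y - x) < s" by (simp add: dist_norm norm_minus_commute)
  then show "\<bar>y $ j - x $ j\<bar> \<le> s"
    using component_le_norm_cart[of "y - x" j] by simp
qed

lemma mixed_ennorm_ball_le:
  assumes s: "0 < s"
  shows "mixed_ennorm p (indicator (ball x s)) \<le> ennreal ((2 * s) powr (\<Sum>j\<in>UNIV. 1 / p j))"
  unfolding mixed_ennorm_cube[OF s, of x, symmetric]
  using ball_subset_cube[of x s] by (intro mixed_ennorm_mono) (auto simp: indicator_def)

lemma mixed_ennorm_ball_ge:
  assumes s: "0 < s"
  shows "ennreal ((s / CARD('n)) powr (\<Sum>j\<in>UNIV. 1 / p j)) \<le> mixed_ennorm p (indicator (ball x s))"
proof -
  \<comment> \<open>The l1 bound on the norm gives at most \<open>CARD('n) * u = s / 2\<close>,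
    inside the open ball; the side \<open>2 * u\<close> is \<open>s / CARD('n)\<close>.\<close>
  define u where "u = s / (2 * CARD('n))"
  have u: "0 < u" using s by (simp add: u_def)
  have "{y. \<forall>j. \<bar>y $ j - x $ j\<bar> \<le> u} \<subseteq> ball x s"
  proof safe
    fix y assume y: "\<forall>j. \<bar>y $ j - x $ j\<bar> \<le> u"
    have "norm (y - x) \<le> (\<Sum>j\<in>UNIV. \<bar>(y - x) $ j\<bar>)"
      by (rule norm_le_l1_cart)
    also have "\<dots> \<le> CARD('n) * u"
      using sum_bounded_above[of UNIV "\<lambda>j. \<bar>(y - x) $ j\<bar>" u] y by simp
    also have "\<dots> < s" using s by (simp add: u_def)
    finally show "y \<in> ball x s" by (simp add: dist_norm norm_minus_commute)
  qed
  then have "mixed_ennorm p (indicator {y. \<forall>j. \<bar>y $ j - x $ j\<bar> \<le> u}) \<le> mixed_ennorm p (indicator (ball x s))"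
    by (intro mixed_ennorm_mono) (auto simp: indicator_def)
  then show ?thesis
    unfolding mixed_ennorm_cube[OF u] by (simp add: u_def)
qed

text \<open>The function stays cut off to the ball; only the box for the coordinatewise inequality
  is the larger cube of side \<open>2 * s\<close>.\<close>

lemma mixed_ennorm_Holder_ball:
  assumes p1: "\<And>j. 1 \<le> p j" and s: "0 < s" and F: "F \<in> borel_measurable lebesgue"
  shows "(\<integral>\<^sup>+ y. F y * indicator (ball x s) y \<partial>lborel) \<le>
    ennreal (2 ^ CARD('n) * (2 * s) powr (\<Sum>j\<in>UNIV. 1 - 1 / p j)) *
    mixed_ennorm p (\<lambda>y. F y * indicator (ball x s) y)"
proof -
  obtain G where G [measurable]: "G \<in> borel_measurable borel" and FG: "AE x in lborel. F x = G x"
    using lebesgue_ex_borel_AE[OF F] .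
  let ?G = "\<lambda>y. G y * indicator (ball x s) y"
  let ?js = "sorted_list_of_set (UNIV :: 'n set)"
  have [measurable]: "ball x s \<in> sets borel"
    by simp
  have G' [measurable]: "?G \<in> borel_measurable borel"
    by measurable
  have "(\<integral>\<^sup>+ y. ?G y \<partial>lborel) = iter_norm (\<lambda>_. 1) ?js ?G 0"
    by (rule nn_integral_eq_iter_norm_one[OF G']) auto
  also have "\<dots> \<le> ennreal (\<Prod>j\<in>set ?js. 2 * (2 * s) powr (1 - 1 / p j)) * iter_norm p ?js ?G 0"
  proof (rule iter_norm_Holder[where I = "\<lambda>j. {x $ j - s .. x $ j + s}"])
    fix y j assume "y $ j \<notin> {x $ j - s .. x $ j + s}"
    then have "\<not> \<bar>y $ j - x $ j\<bar> \<le> s" by auto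
    then have "y \<notin> ball x s" using ball_subset_cube[of x s] by blast
    then show "?G y = 0" by simp
  qed (use s p1 G' in auto)
  also have "(\<Prod>j\<in>set ?js. 2 * (2 * s) powr (1 - 1 / p j)) =
      2 ^ CARD('n) * (2 * s) powr (\<Sum>j\<in>UNIV. 1 - 1 / p j)"
    using s by (simp add: prod.distrib powr_sum)
  finally have "(\<integral>\<^sup>+ y. ?G y \<partial>lborel) \<le>
      ennreal (2 ^ CARD('n) * (2 * s) powr (\<Sum>j\<in>UNIV. 1 - 1 / p j)) * mixed_ennorm p ?G"
    by (simp add: mixed_ennorm_def)
  moreover have "(\<integral>\<^sup>+ y. F y * indicator (ball x s) y \<partial>lborel) = (\<integral>\<^sup>+ y. ?G y \<partial>lborel)"
    using FG by (intro nn_integral_cong_AE) (auto elim: eventually_mono)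
  moreover have "mixed_ennorm p (\<lambda>y. F y * indicator (ball x s) y) = mixed_ennorm p ?G"
    using FG by (intro mixed_ennorm_cong_AE) (auto elim: eventually_mono)
  ultimately show ?thesis by simp
qed

end

section \<open>Estimates by Morrey norms\<close>

lemma ennreal_inverse_mult_self: "0 < a \<Longrightarrow> a < top \<Longrightarrow> inverse a * a = (1::ennreal)"
  using ennreal_divide_self[of a] by (simp add: divide_ennreal_def mult.commute)

text \<open>The sections of a weight need not be measurable, so the right-hand side is a lower integral.\<close>

lemma nn_integral_le_cmult:
  assumes h: "h \<in> borel_measurable M" and c: "c < top" and le: "\<And>t. h t \<le> c * u t"
  shows "(\<integral>\<^sup>+ t. h t \<partial>M) \<le> c * (\<integral>\<^sup>+ t. u t \<partial>M)"
proof (cases "c = 0")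
  case True
  then show ?thesis using le by simp
next
  case False
  then have inv: "inverse c * c = 1"
    using c by (intro ennreal_inverse_mult_self) (simp add: zero_less_iff_neq_zero)
  have "(\<integral>\<^sup>+ t. h t \<partial>M) = (inverse c * c) * (\<integral>\<^sup>+ t. h t \<partial>M)"
    by (simp add: inv)
  also have "\<dots> = c * (inverse c * (\<integral>\<^sup>+ t. h t \<partial>M))"
    by (simp only: mult_ac)
  also have "inverse c * (\<integral>\<^sup>+ t. h t \<partial>M) = (\<integral>\<^sup>+ t. inverse c * h t \<partial>M)"
    using h by (rule nn_integral_cmult[symmetric])
  also have "\<dots> \<le> (\<integral>\<^sup>+ t. u t \<partial>M)"
  proof (rule nn_integral_mono)
    fix t
    have "inverse c * h t \<le> inverse c * (c * u t)"
      by (intro mult_left_mono le) simp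
    also have "\<dots> = u t"
      by (simp only: mult.assoc[symmetric] inv mult_1)
    finally show "inverse c * h t \<le> u t" .
  qed
  finally show ?thesis by (simp add: mult_left_mono)
qed

lemma mixed_norm_times_indicator:
  "mixed_norm (\<lambda>j. ennreal (q j)) (\<lambda>y. f y * indicator B y) =
    mixed_ennorm q (\<lambda>y. ennreal (cmod (f y)) * indicator B y)"
proof -
  have "ennreal (cmod (f y * indicator B y)) = ennreal (cmod (f y)) * indicator B y" for y
    by (simp add: indicator_def)
  then show ?thesis by (simp add: mixed_norm_eq_mixed_ennorm)
qed

lemma mixed_norm_of_indicator:
  "mixed_norm (\<lambda>j. ennreal (q j)) (indicator B) = mixed_ennorm q (indicator B)"
proof -
  have "(\<lambda>y. ennreal (cmod (indicator B y))) = indicator B"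
    by (auto simp: indicator_def)
  then show ?thesis by (simp add: mixed_norm_eq_mixed_ennorm)
qed

context
  fixes q :: "'n::{finite,linorder} \<Rightarrow> real"
  assumes q: "\<And>j. 0 < q j"
begin

lemma mixed_ennorm_ball_pos: "0 < s \<Longrightarrow> 0 < mixed_ennorm q (indicator (ball x s))"
  by (rule less_le_trans[OF _ mixed_ennorm_ball_ge[OF q]]) auto

lemma mixed_ennorm_ball_finite: "0 < s \<Longrightarrow> mixed_ennorm q (indicator (ball x s)) < top"
  by (rule le_less_trans[OF mixed_ennorm_ball_le[OF q]]) auto

lemma mixed_ennorm_le_morrey_norm:
  fixes f :: "(real, 'n) vec \<Rightarrow> complex"
  assumes r: "0 < r" and \<phi>: "0 < \<phi> x r"
  shows "mixed_ennorm q (\<lambda>y. ennreal (cmod (f y)) * indicator (ball x r) y) \<le>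
    morrey_norm \<phi> q f * ennreal (\<phi> x r) * ennreal ((2 * r) powr (\<Sum>j\<in>UNIV. 1 / q j))"
proof -
  let ?X = "mixed_ennorm q (\<lambda>y. ennreal (cmod (f y)) * indicator (ball x r) y)"
  let ?a = "ennreal (\<phi> x r)" and ?b = "mixed_ennorm q (indicator (ball x r))"
  have "inverse ?a * inverse ?b * ?X \<le> morrey_norm \<phi> q f"
    unfolding morrey_norm_def mixed_norm_times_indicator mixed_norm_of_indicator
    by (rule SUP_upper2[of "(x, r)"]) (use r in auto)
  then have "?a * ?b * (inverse ?a * inverse ?b * ?X) \<le> ?a * ?b * morrey_norm \<phi> q f"
    by (intro mult_left_mono) auto
  also have "?a * ?b * (inverse ?a * inverse ?b * ?X) = (inverse ?a * ?a) * (inverse ?b * ?b) * ?X"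
    by (simp add: mult_ac)
  also have "inverse ?a * ?a = 1"
    using \<phi> by (intro ennreal_inverse_mult_self) auto
  also have "inverse ?b * ?b = 1"
    using mixed_ennorm_ball_pos[OF r] mixed_ennorm_ball_finite[OF r] by (intro ennreal_inverse_mult_self) auto
  finally have "?X \<le> morrey_norm \<phi> q f * ?a * ?b"
    by (simp add: mult_ac)
  also have "\<dots> \<le> morrey_norm \<phi> q f * ?a * ennreal ((2 * r) powr (\<Sum>j\<in>UNIV. 1 / q j))"
    by (intro mult_left_mono mixed_ennorm_ball_le q r) simp
  finally show ?thesis .
qed

text \<open>\<open>\<parallel>f \<chi>\<^bsub>B(x,2r)\<^esub>\<parallel>\<close> is averaged over the larger balls \<open>B(x,t)\<close>, \<open>2r < t < 4r\<close>.\<close>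

lemma mixed_ennorm_near_le:
  fixes f :: "(real, 'n) vec \<Rightarrow> complex"
  assumes r: "0 < r" and \<phi>: "\<And>t. 0 < t \<Longrightarrow> 0 < \<phi> x t" and fin: "morrey_norm \<phi> q f < top"
  shows "mixed_ennorm q (\<lambda>y. ennreal (cmod (f y)) * indicator (ball x (2 * r)) y) \<le>
    ennreal (2 * (8 * r) powr (\<Sum>j\<in>UNIV. 1 / q j)) *
    (morrey_norm \<phi> q f * (\<integral>\<^sup>+ t\<in>{r<..}. ennreal (\<phi> x t / t) \<partial>lebesgue))"
proof -
  let ?S = "\<Sum>j\<in>UNIV. 1 / q j"
  let ?X = "\<lambda>t. mixed_ennorm q (\<lambda>y. ennreal (cmod (f y)) * indicator (ball x t) y)"
  let ?M = "morrey_norm \<phi> q f"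
  have S: "0 \<le> ?S" using q by (intro sum_nonneg) (simp add: less_imp_le)
  \<comment> \<open>On an interval of length \<open>2 * r\<close>, the constant
    \<open>1 / (4 * r)\<close> is a lower bound for \<open>1 / t\<close>, and B(x, t) contains B(x,
    2r). The integral of \<open>h\<close> is half the norm to be estimated.\<close>
  define h where "h t = ?X (2 * r) * ennreal (1 / (4 * r)) * indicator {2 * r<..<4 * r} t" for t
  have h_le: "h t \<le> (ennreal ((8 * r) powr ?S) * ?M) * (ennreal (\<phi> x t / t) * indicator {r<..} t)" for t
  proof (cases "t \<in> {2 * r<..<4 * r}")
    case False
    then show ?thesis by (simp add: h_def)
  next
    case True
    then have t: "0 < t" "2 * r < t" "t < 4 * r" "r < t" using r by auto
    have "h t = ?X (2 * r) * ennreal (1 / (4 * r))"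
      using True by (simp add: h_def)
    also have "\<dots> \<le> ?X t * ennreal (1 / t)"
      using t r by (intro mult_mono ennreal_leI mixed_ennorm_mono q) (auto simp: indicator_def frac_le)
    also have "\<dots> \<le> (?M * ennreal (\<phi> x t) * ennreal ((2 * t) powr ?S)) * ennreal (1 / t)"
      by (intro mult_right_mono mixed_ennorm_le_morrey_norm t \<phi>) auto
    also have "\<dots> \<le> (?M * ennreal (\<phi> x t) * ennreal ((8 * r) powr ?S)) * ennreal (1 / t)"
      using t S by (intro mult_right_mono mult_left_mono ennreal_leI powr_mono2) auto
    also have "\<dots> = (ennreal ((8 * r) powr ?S) * ?M) * (ennreal (\<phi> x t) * ennreal (1 / t))"
      by (simp add: mult_ac)
    also have "ennreal (\<phi> x t) * ennreal (1 / t) = ennreal (\<phi> x t / t)"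
      using t \<phi>[OF t(1)] by (simp flip: ennreal_mult)
    finally show ?thesis
      using t by simp
  qed
  have "?X (2 * r) = ennreal 2 * (?X (2 * r) * (ennreal (1 / (4 * r)) * ennreal (2 * r)))"
  proof -
    have "ennreal (1 / (4 * r)) * ennreal (2 * r) = ennreal (1 / 2)"
      using r by (simp flip: ennreal_mult)
    moreover have "ennreal 2 * ennreal (1 / 2) = 1"
      by (subst ennreal_mult[symmetric]) auto
    ultimately show ?thesis by (simp only: mult.left_commute[of "ennreal 2"] mult_1_right)
  qed
  also have "?X (2 * r) * (ennreal (1 / (4 * r)) * ennreal (2 * r)) = (\<integral>\<^sup>+ t. h t \<partial>lebesgue)"
    unfolding nn_integral_completion h_def using r by (simp add: nn_integral_cmult mult.assoc)
  also have "\<dots> \<le> (ennreal ((8 * r) powr ?S) * ?M) * (\<integral>\<^sup>+ t\<in>{r<..}. ennreal (\<phi> x t / t) \<partial>lebesgue)"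
  proof (rule nn_integral_le_cmult[OF _ _ h_le])
    show "h \<in> borel_measurable lebesgue"
      unfolding h_def by (rule measurable_completion) measurable
    show "ennreal ((8 * r) powr ?S) * ?M < top"
      using fin by (simp add: ennreal_mult_less_top)
  qed
  finally have "?X (2 * r) \<le> ennreal 2 *
      ((ennreal ((8 * r) powr ?S) * ?M) * (\<integral>\<^sup>+ t\<in>{r<..}. ennreal (\<phi> x t / t) \<partial>lebesgue))"
    by (simp add: mult_left_mono)
  also have "\<dots> = (ennreal 2 * ennreal ((8 * r) powr ?S)) *
      (?M * (\<integral>\<^sup>+ t\<in>{r<..}. ennreal (\<phi> x t / t) \<partial>lebesgue))"
    by (simp only: mult.assoc)
  also have "ennreal 2 * ennreal ((8 * r) powr ?S) = ennreal (2 * (8 * r) powr ?S)"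
    by (rule ennreal_mult[symmetric]) auto
  finally show ?thesis .
qed

text \<open>The powers of \<open>t\<close> cancel: Hoelder's inequality contributes the exponents
  \<open>1 - 1 / q j\<close>, the Morrey norm the exponents \<open>1 / q j\<close>, together n,
  against n + 1 from the layers of the kernel. What remains of the weight is
  \<open>\<phi> x t / t\<close>.\<close>

lemma nn_integral_far_le:
  fixes f :: "(real, 'n) vec \<Rightarrow> complex"
  assumes q1: "\<And>j. 1 \<le> q j" and r: "0 < r" and \<phi>: "\<And>t. 0 < t \<Longrightarrow> 0 < \<phi> x t"
    and f: "f \<in> borel_measurable lebesgue" and fin: "morrey_norm \<phi> q f < top"
  shows "(\<integral>\<^sup>+ y. ennreal (cmod (f y)) * ennreal (1 / max r (dist x y) ^ CARD('n)) \<partial>lborel) \<le>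
    ennreal (2 * 8 ^ CARD('n)) *
    (morrey_norm \<phi> q f * (\<integral>\<^sup>+ t\<in>{r<..}. ennreal (\<phi> x t / t) \<partial>lebesgue))"
proof -
  let ?n = "CARD('n)" and ?S = "\<Sum>j\<in>UNIV. 1 / q j"
  let ?M = "morrey_norm \<phi> q f"
  have fm: "(\<lambda>y. ennreal (cmod (f y))) \<in> borel_measurable lebesgue"
    using f by measurable
  obtain g where g [measurable]: "g \<in> borel_measurable borel" and fg: "AE y in lborel. ennreal (cmod (f y)) = g y"
    using lebesgue_ex_borel_AE[OF fm] .
  define w where "w t = indicator {r<..} t * ennreal (1 / t ^ (?n + 1))" for t :: real
  have [measurable]: "w \<in> borel_measurable borel" unfolding w_def by measurable
  \<comment> \<open>The range from \<open>m\<close> to \<open>2 * m\<close> already recovers the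
    kernel: its length is \<open>m\<close>, and there the integrand is at least its value at
    \<open>2 * m\<close>.\<close>
  have kernel: "ennreal (1 / max r (dist x y) ^ ?n) \<le>
      ennreal (2 * 2 ^ ?n) * (\<integral>\<^sup>+ t. w t * indicator {t. dist x y < t} t \<partial>lborel)" for y
  proof -
    define m where "m = max r (dist x y)"
    have m: "0 < m" using r by (simp add: m_def)
    have "ennreal (1 / m ^ ?n) = ennreal (2 * 2 ^ ?n) * (ennreal (1 / (2 * m) ^ (?n + 1)) * ennreal m)"
      using m by (simp add: power_mult_distrib flip: ennreal_mult)
    also have "ennreal (1 / (2 * m) ^ (?n + 1)) * ennreal m =
        (\<integral>\<^sup>+ t. ennreal (1 / (2 * m) ^ (?n + 1)) * indicator {m<..2 * m} t \<partial>lborel)"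
      using m by (subst nn_integral_cmult) auto
    also have "\<dots> \<le> (\<integral>\<^sup>+ t. w t * indicator {t. dist x y < t} t \<partial>lborel)"
    proof (rule nn_integral_mono)
      fix t
      show "ennreal (1 / (2 * m) ^ (?n + 1)) * indicator {m<..2 * m} t \<le> w t * indicator {t. dist x y < t} t"
      proof (cases "t \<in> {m<..2 * m}")
        case True
        then have t: "0 < t" "r < t" "dist x y < t" "t \<le> 2 * m" using m by (auto simp: m_def)
        have "1 / (2 * m) ^ (?n + 1) \<le> 1 / t ^ (?n + 1)"
          using t by (intro divide_left_mono power_mono) auto
        then show ?thesis
          using t True by (simp add: w_def ennreal_leI del: power_Suc)
      qed simp
    qed
    finally show ?thesis by (simp add: m_def mult_left_mono)
  qed
  \<comment> \<open>Formed with the Borel representative \<open>g\<close>, so that Tonelli's theorem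
    applies and \<open>h\<close> is measurable, as the comparison with a lower integral
    requires.\<close>
  define h where "h t = w t * (\<integral>\<^sup>+ y. g y * indicator {t. dist x y < t} t \<partial>lborel)" for t
  have [measurable]: "h \<in> borel_measurable borel" unfolding h_def by measurable
  have "(\<integral>\<^sup>+ y. ennreal (cmod (f y)) * ennreal (1 / max r (dist x y) ^ ?n) \<partial>lborel) =
      (\<integral>\<^sup>+ y. g y * ennreal (1 / max r (dist x y) ^ ?n) \<partial>lborel)"
    using fg by (intro nn_integral_cong_AE) (auto elim: eventually_mono)
  also have "\<dots> \<le> (\<integral>\<^sup>+ y. g y * (ennreal (2 * 2 ^ ?n) *
      (\<integral>\<^sup>+ t. w t * indicator {t. dist x y < t} t \<partial>lborel)) \<partial>lborel)"
    by (intro nn_integral_mono mult_left_mono kernel) simp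
  also have "\<dots> = ennreal (2 * 2 ^ ?n) * (\<integral>\<^sup>+ y. g y *
      (\<integral>\<^sup>+ t. w t * indicator {t. dist x y < t} t \<partial>lborel) \<partial>lborel)"
    by (subst nn_integral_cmult[symmetric]) (auto simp: mult_ac)
  also have "(\<integral>\<^sup>+ y. g y * (\<integral>\<^sup>+ t. w t * indicator {t. dist x y < t} t \<partial>lborel) \<partial>lborel) =
      (\<integral>\<^sup>+ y. (\<integral>\<^sup>+ t. g y * (w t * indicator {t. dist x y < t} t) \<partial>lborel) \<partial>lborel)"
    by (subst nn_integral_cmult) auto
  also have "\<dots> = (\<integral>\<^sup>+ t. (\<integral>\<^sup>+ y. g y * (w t * indicator {t. dist x y < t} t) \<partial>lborel) \<partial>lborel)"
    by (rule lborel_pair.Fubini'[symmetric]) measurable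
  also have "\<dots> = (\<integral>\<^sup>+ t. h t \<partial>lborel)"
    unfolding h_def by (subst nn_integral_cmult[symmetric]) (auto simp: mult_ac)
  also have "\<dots> = (\<integral>\<^sup>+ t. h t \<partial>lebesgue)"
    by (simp add: nn_integral_completion)
  also have "\<dots> \<le> (ennreal (4 ^ ?n) * ?M) * (\<integral>\<^sup>+ t\<in>{r<..}. ennreal (\<phi> x t / t) \<partial>lebesgue)"
  proof (rule nn_integral_le_cmult)
    show "h \<in> borel_measurable lebesgue"
      by (rule measurable_completion) simp
    show "ennreal (4 ^ ?n) * ?M < top"
      using fin by (simp add: ennreal_mult_less_top)
    fix t
    show "h t \<le> (ennreal (4 ^ ?n) * ?M) * (ennreal (\<phi> x t / t) * indicator {r<..} t)"
    proof (cases "r < t")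
      case False
      then show ?thesis by (simp add: h_def w_def)
    next
      case True
      then have t: "0 < t" using r by simp
      have "(\<integral>\<^sup>+ y. g y * indicator {t. dist x y < t} t \<partial>lborel) =
          (\<integral>\<^sup>+ y. ennreal (cmod (f y)) * indicator (ball x t) y \<partial>lborel)"
        using fg by (intro nn_integral_cong_AE) (auto elim!: eventually_mono simp: indicator_def)
      also have "\<dots> \<le> ennreal (2 ^ ?n * (2 * t) powr (\<Sum>j\<in>UNIV. 1 - 1 / q j)) *
          mixed_ennorm q (\<lambda>y. ennreal (cmod (f y)) * indicator (ball x t) y)"
        by (rule mixed_ennorm_Holder_ball[OF q q1 t fm])
      also have "\<dots> \<le> ennreal (2 ^ ?n * (2 * t) powr (\<Sum>j\<in>UNIV. 1 - 1 / q j)) *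
          (?M * ennreal (\<phi> x t) * ennreal ((2 * t) powr ?S))"
        by (intro mult_left_mono mixed_ennorm_le_morrey_norm t \<phi>) simp
      also have "\<dots> = (ennreal (2 ^ ?n * (2 * t) powr (\<Sum>j\<in>UNIV. 1 - 1 / q j)) *
          ennreal ((2 * t) powr ?S)) * (?M * ennreal (\<phi> x t))"
        by (simp add: mult_ac)
      also have "ennreal (2 ^ ?n * (2 * t) powr (\<Sum>j\<in>UNIV. 1 - 1 / q j)) * ennreal ((2 * t) powr ?S) =
          ennreal (4 ^ ?n * t ^ ?n)"
      proof -
        have four: "(4::real) ^ ?n = 2 ^ ?n * 2 ^ ?n"
          by (simp flip: power_mult_distrib)
        have "(2 * t) powr (\<Sum>j\<in>UNIV. 1 - 1 / q j) * (2 * t) powr ?S = (2 * t) powr real ?n"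
          by (simp add: sum_subtractf flip: powr_add)
        also have "\<dots> = (2 * t) ^ ?n"
          using t by (intro powr_realpow) simp
        finally have "2 ^ ?n * (2 * t) powr (\<Sum>j\<in>UNIV. 1 - 1 / q j) * (2 * t) powr ?S = 4 ^ ?n * t ^ ?n"
          by (simp add: four mult.assoc power_mult_distrib)
        then show ?thesis
          by (subst ennreal_mult[symmetric]) auto
      qed
      finally have "h t \<le> ennreal (1 / t ^ (?n + 1)) * (ennreal (4 ^ ?n * t ^ ?n) * (?M * ennreal (\<phi> x t)))"
        using True by (simp add: h_def w_def mult_left_mono del: power_Suc)
      also have "\<dots> = (ennreal (1 / t ^ (?n + 1)) * ennreal (4 ^ ?n * t ^ ?n) * ennreal (\<phi> x t)) * ?M"
        by (simp add: mult_ac)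
      also have "ennreal (1 / t ^ (?n + 1)) * ennreal (4 ^ ?n * t ^ ?n) * ennreal (\<phi> x t) =
          ennreal (4 ^ ?n) * ennreal (\<phi> x t / t)"
        using t \<phi>[OF t] by (simp flip: ennreal_mult)
      finally show ?thesis
        using True by (simp add: mult_ac)
    qed
  qed
  finally have "(\<integral>\<^sup>+ y. ennreal (cmod (f y)) * ennreal (1 / max r (dist x y) ^ ?n) \<partial>lborel) \<le>
      (ennreal (2 * 2 ^ ?n) * ennreal (4 ^ ?n)) * (?M * (\<integral>\<^sup>+ t\<in>{r<..}. ennreal (\<phi> x t / t) \<partial>lebesgue))"
    by (simp add: mult_left_mono mult.assoc)
  also have "ennreal (2 * 2 ^ ?n) * ennreal (4 ^ ?n) = ennreal (2 * 8 ^ ?n)"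
    by (subst ennreal_mult[symmetric]) (auto simp flip: power_mult_distrib)
  finally show ?thesis .
qed

end

section \<open>Sublinear operators with a size condition\<close>

text \<open>The far entry \<open>z $ k\<close> makes the norm of the tuple at least
  \<open>r\<close>, and moving from \<open>y\<close> to the centre \<open>x\<close> costs at most
  \<open>r\<close>; hence the factor 2 for every entry.\<close>

lemma max_dist_le_norm:
  fixes z :: "'a::euclidean_space ^ 'm"
  assumes y: "y \<in> ball x r" and z: "z $ k \<notin> ball x (2 * r)"
  shows "max r (dist x (z $ i)) \<le> 2 * norm (\<chi> i. y - z $ i)"
proof -
  let ?D = "norm (\<chi> i. y - z $ i)"
  have D: "dist y (z $ i) \<le> ?D" for i
    using Finite_Cartesian_Product.norm_nth_le[of "\<chi> i. y - z $ i" i] by (simp add: dist_norm)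
  have "r \<le> dist y (z $ k)"
    using y z dist_triangle[of x "z $ k" y] by simp
  then have "r \<le> ?D" using D[of k] by simp
  moreover have "dist x (z $ i) \<le> r + ?D"
    using dist_triangle[of x "z $ i" y] y D[of i] by simp
  moreover have "0 \<le> ?D" by simp
  ultimately show ?thesis
    by (intro max.boundedI) linarith+
qed

text \<open>Since one of the variables stays away from \<open>x\<close>, the joint kernel is dominated by a product of
  kernels in the single variables.\<close>

lemma size_bound:
  fixes T :: "('m::finite \<Rightarrow> (real, 'n::{finite,linorder}) vec \<Rightarrow> complex) \<Rightarrow> (real, 'n) vec \<Rightarrow> complex"
  assumes C: "\<And>f x. (\<forall>i. f i \<in> L1_compact) \<Longrightarrow> x \<notin> (\<Inter>i. closed_support (f i)) \<Longrightarrow>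
      ennreal (cmod (T f x)) \<le>
        ennreal C * (\<integral>\<^sup>+ y. ennreal ((\<Prod>i\<in>UNIV. cmod (f i (y $ i))) /
          norm (\<chi> i. x - y $ i) ^ (CARD('m) * CARD('n))) \<partial>(lebesgue :: (((real, 'n) vec, 'm) vec) measure))"
    and r: "0 < r" and y: "y \<in> ball x r"
    and g: "\<And>i. g i \<in> L1_compact"
    and f: "\<And>i. f i \<in> borel_measurable lebesgue" and le: "\<And>i y. cmod (g i y) \<le> cmod (f i y)"
    and far: "\<And>y. y \<in> ball x (2 * r) \<Longrightarrow> g k y = 0"
  shows "ennreal (cmod (T g y)) \<le> ennreal C * (\<Prod>i\<in>UNIV. ennreal (2 ^ CARD('n)) *
    (\<integral>\<^sup>+ v. ennreal (cmod (f i v)) * ennreal (1 / max r (dist x v) ^ CARD('n)) \<partial>lborel))"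
proof -
  let ?n = "CARD('n)" and ?m = "CARD('m)"
  let ?H = "\<lambda>v. ennreal (2 ^ ?n) * ennreal (1 / max r (dist x v) ^ ?n)"
  have fm: "(\<lambda>v. ennreal (cmod (f i v))) \<in> borel_measurable lebesgue" for i
    using f[of i] by measurable
  have "\<exists>G. G \<in> borel_measurable borel \<and> (AE v in lborel. ennreal (cmod (f i v)) = G v)" for i
    using lebesgue_ex_borel_AE[OF fm] by metis
  then obtain G where G [measurable]: "\<And>i. G i \<in> borel_measurable borel"
    and fG: "\<And>i. AE v in lborel. ennreal (cmod (f i v)) = G i v"
    by metis
  \<comment> \<open>The complement of an open ball is closed, so taking the closure does not reach
    \<open>y\<close>. One far argument suffices to leave the intersection of the supports.\<close>
  have "closed_support (g k) \<subseteq> - ball x (2 * r)"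
    unfolding closed_support_def using far by (intro closure_minimal) auto
  then have "y \<notin> (\<Inter>i. closed_support (g i))"
    using y r by auto
  then have "ennreal (cmod (T g y)) \<le>
      ennreal C * (\<integral>\<^sup>+ z. ennreal ((\<Prod>i\<in>UNIV. cmod (g i (z $ i))) /
        norm (\<chi> i. y - z $ i) ^ (?m * ?n)) \<partial>(lborel :: (((real, 'n) vec, 'm) vec) measure))"
    using C[of g y] g by (simp add: nn_integral_completion)
  also have "\<dots> \<le> ennreal C * (\<integral>\<^sup>+ z. (\<Prod>i\<in>UNIV. G i (z $ i) * ?H (z $ i))
      \<partial>(lborel :: (((real, 'n) vec, 'm) vec) measure))"
  proof (intro mult_left_mono nn_integral_mono_AE)
    have "AE z :: ((real, 'n) vec, 'm) vec in lborel. \<forall>i\<in>UNIV. ennreal (cmod (f i (z $ i))) = G i (z $ i)"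
      using AE_component[OF fG] by (intro AE_finite_allI) auto
    then show "AE z :: ((real, 'n) vec, 'm) vec in lborel.
        ennreal ((\<Prod>i\<in>UNIV. cmod (g i (z $ i))) / norm (\<chi> i. y - z $ i) ^ (?m * ?n)) \<le>
        (\<Prod>i\<in>UNIV. G i (z $ i) * ?H (z $ i))"
    proof eventually_elim
      case (elim z)
      show ?case
      \<comment> \<open>Where this factor vanishes so does the integrand; elsewhere
        \<open>z $ k\<close> lies outside B(x, 2r), as the kernel estimate requires.\<close>
      proof (cases "g k (z $ k) = 0")
        case True
        then have "(\<Prod>i\<in>UNIV. cmod (g i (z $ i))) = 0"
          by (intro prod_zero) auto
        then show ?thesis by (simp del: prod_zero_iff)
      next
        case False
        let ?D = "norm (\<chi> i. y - z $ i)"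
        have D: "max r (dist x (z $ i)) \<le> 2 * ?D" for i
          using False far y by (intro max_dist_le_norm[of y x r z k]) auto
        \<comment> \<open>The exponent \<open>m * n\<close> leaves exactly one n-th power of the
          norm for each variable.\<close>
        have "(\<Prod>i\<in>UNIV. cmod (g i (z $ i))) / ?D ^ (?m * ?n) = (\<Prod>i\<in>UNIV. cmod (g i (z $ i)) / ?D ^ ?n)"
          by (simp add: prod_dividef power_mult[symmetric] mult.commute)
        also have "\<dots> \<le> (\<Prod>i\<in>UNIV. cmod (f i (z $ i)) * (2 ^ ?n * (1 / max r (dist x (z $ i)) ^ ?n)))"
        proof (rule prod_mono, intro conjI)
          fix i
          let ?m = "max r (dist x (z $ i))"
          have m: "0 < ?m" using r by simp
          have "?m ^ ?n \<le> (2 * ?D) ^ ?n" using D[of i] m by (intro power_mono) auto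
          then have "1 / ?D ^ ?n \<le> 2 ^ ?n * (1 / ?m ^ ?n)"
          proof -
            have "0 < ?D" using m D[of i] by linarith
            then have "0 < ?D ^ ?n" "0 < ?m ^ ?n" using m by auto
            then show ?thesis
              using \<open>?m ^ ?n \<le> (2 * ?D) ^ ?n\<close>
              by (simp add: power_mult_distrib divide_simps mult.commute del: zero_less_power_eq)
          qed
          then have "cmod (g i (z $ i)) * (1 / ?D ^ ?n) \<le> cmod (f i (z $ i)) * (2 ^ ?n * (1 / ?m ^ ?n))"
            by (intro mult_mono le) auto
          then show "cmod (g i (z $ i)) / ?D ^ ?n \<le> cmod (f i (z $ i)) * (2 ^ ?n * (1 / ?m ^ ?n))"
            by simp
        qed simp
        finally have "ennreal ((\<Prod>i\<in>UNIV. cmod (g i (z $ i))) / ?D ^ (?m * ?n)) \<le>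
            ennreal (\<Prod>i\<in>UNIV. cmod (f i (z $ i)) * (2 ^ ?n * (1 / max r (dist x (z $ i)) ^ ?n)))"
          by (rule ennreal_leI)
        also have "\<dots> = (\<Prod>i\<in>UNIV. ennreal (cmod (f i (z $ i))) * ?H (z $ i))"
        proof -
          have m: "0 \<le> 1 / max r (dist x (z $ i)) ^ ?n" for i using r by simp
          have mult3: "ennreal a * (ennreal b * ennreal c) = ennreal (a * (b * c))"
            if "0 \<le> a" "0 \<le> b" "0 \<le> c" for a b c
            using that by (simp add: ennreal_mult)
          have "ennreal (cmod (f i (z $ i))) * ?H (z $ i) =
              ennreal (cmod (f i (z $ i)) * (2 ^ ?n * (1 / max r (dist x (z $ i)) ^ ?n)))" for i
            by (rule mult3[OF _ _ m]) auto
          moreover have "0 \<le> cmod (f i (z $ i)) * (2 ^ ?n * (1 / max r (dist x (z $ i)) ^ ?n))" for i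
            using m[of i] by (intro mult_nonneg_nonneg) auto
          ultimately show ?thesis
            by (simp only: prod_ennreal)
        qed
        finally show ?thesis
          using elim by simp
      qed
    qed
  qed simp
  also have "(\<integral>\<^sup>+ z. (\<Prod>i\<in>UNIV. G i (z $ i) * ?H (z $ i)) \<partial>(lborel :: (((real, 'n) vec, 'm) vec) measure)) =
      (\<Prod>i\<in>UNIV. \<integral>\<^sup>+ v. G i v * ?H v \<partial>lborel)"
    by (rule nn_integral_prod_vec) measurable
  also have "\<dots> = (\<Prod>i\<in>UNIV. ennreal (2 ^ ?n) *
      (\<integral>\<^sup>+ v. ennreal (cmod (f i v)) * ennreal (1 / max r (dist x v) ^ ?n) \<partial>lborel))"
  proof (rule prod.cong)
    fix i
    have "(\<integral>\<^sup>+ v. G i v * ?H v \<partial>lborel) =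
        ennreal (2 ^ ?n) * (\<integral>\<^sup>+ v. G i v * ennreal (1 / max r (dist x v) ^ ?n) \<partial>lborel)"
      by (subst nn_integral_cmult[symmetric]) (auto simp: mult_ac)
    also have "(\<integral>\<^sup>+ v. G i v * ennreal (1 / max r (dist x v) ^ ?n) \<partial>lborel) =
        (\<integral>\<^sup>+ v. ennreal (cmod (f i v)) * ennreal (1 / max r (dist x v) ^ ?n) \<partial>lborel)"
      using fG[of i] by (intro nn_integral_cong_AE) (auto elim: eventually_mono)
    finally show "(\<integral>\<^sup>+ v. G i v * ?H v \<partial>lborel) = ennreal (2 ^ ?n) *
        (\<integral>\<^sup>+ v. ennreal (cmod (f i v)) * ennreal (1 / max r (dist x v) ^ ?n) \<partial>lborel)" .
  qed simp
  finally show ?thesis .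
qed

text \<open>Induction on the set of slots that are split. \<open>h\<close> fills the others and must
  be general, since splitting slot \<open>j\<close> leads to \<open>h(j := a j)\<close> and
  \<open>h(j := b j)\<close>.\<close>

lemma multi_sublinear_expand_on:
  fixes T :: "('m::finite \<Rightarrow> real ^ 'n \<Rightarrow> complex) \<Rightarrow> real ^ 'n \<Rightarrow> complex"
  assumes T: "multi_sublinear V T" and V: "\<And>i. function_space (V i)"
    and a: "\<And>i. a i \<in> V i" and b: "\<And>i. b i \<in> V i" and h: "\<And>i. h i \<in> V i"
  shows "AE x in lebesgue. cmod (T (\<lambda>i. if i \<in> S then (\<lambda>y. a i y + b i y) else h i) x) \<le>
    (\<Sum>A\<in>Pow S. cmod (T (\<lambda>i. if i \<in> A then b i else if i \<in> S then a i else h i) x))"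
  using finite[of S] h
proof (induction S arbitrary: h rule: finite_induct)
  case empty
  show ?case by simp
next
  case (insert j S)
  let ?s = "\<lambda>h i. if i \<in> S then (\<lambda>y. a i y + b i y) else h i"
  let ?t = "\<lambda>A h i. if i \<in> A then b i else if i \<in> S then a i else h i"
  let ?u = "\<lambda>A i. if i \<in> A then b i else if i \<in> insert j S then a i else h i"
  define f where "f = ?s (h(j := a j))"
  have fj: "f j = a j" using insert.hyps by (simp add: f_def)
  have fV: "f i \<in> V i" for i
    using a b V insert.prems by (auto simp: f_def function_space_def)
  have "AE x in lebesgue. cmod (T (f(j := (\<lambda>y. f j y + b j y))) x) \<le>
      cmod (T f x) + cmod (T (f(j := b j)) x)"
    using T fV b unfolding multi_sublinear_def by blast
  moreover have "f(j := (\<lambda>y. f j y + b j y)) =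
      (\<lambda>i. if i \<in> insert j S then (\<lambda>y. a i y + b i y) else h i)"
    using insert.hyps by (auto simp: f_def fun_eq_iff)
  moreover have "f(j := b j) = ?s (h(j := b j))"
    using insert.hyps by (auto simp: f_def fun_eq_iff)
  moreover have "AE x in lebesgue. cmod (T (?s (h(j := a j))) x) \<le> (\<Sum>A\<in>Pow S. cmod (T (?t A (h(j := a j))) x))"
    using insert.prems a by (intro insert.IH) auto
  moreover have "AE x in lebesgue. cmod (T (?s (h(j := b j))) x) \<le> (\<Sum>A\<in>Pow S. cmod (T (?t A (h(j := b j))) x))"
    using insert.prems b by (intro insert.IH) auto
  ultimately have "AE x in lebesgue. cmod (T (\<lambda>i. if i \<in> insert j S then (\<lambda>y. a i y + b i y) else h i) x) \<le>
      (\<Sum>A\<in>Pow S. cmod (T (?t A (h(j := a j))) x)) + (\<Sum>A\<in>Pow S. cmod (T (?t A (h(j := b j))) x))"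
    unfolding f_def[symmetric] by auto
  moreover have "(\<Sum>A\<in>Pow (insert j S). cmod (T (?u A) x)) =
      (\<Sum>A\<in>Pow S. cmod (T (?t A (h(j := a j))) x)) + (\<Sum>A\<in>Pow S. cmod (T (?t A (h(j := b j))) x))" for x
  proof -
    have inj: "inj_on (insert j) (Pow S)"
      using insert.hyps by (auto simp: inj_on_def)
    have "(\<Sum>A\<in>Pow (insert j S). cmod (T (?u A) x)) =
        (\<Sum>A\<in>Pow S. cmod (T (?u A) x)) + (\<Sum>A\<in>insert j ` Pow S. cmod (T (?u A) x))"
      unfolding Pow_insert using insert.hyps by (intro sum.union_disjoint) auto
    also have "(\<Sum>A\<in>insert j ` Pow S. cmod (T (?u A) x)) = (\<Sum>A\<in>Pow S. cmod (T (?u (insert j A)) x))"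
      using inj by (simp add: sum.reindex)
    also have "(\<Sum>A\<in>Pow S. cmod (T (?u (insert j A)) x)) = (\<Sum>A\<in>Pow S. cmod (T (?t A (h(j := b j))) x))"
    proof (rule sum.cong)
      fix A assume "A \<in> Pow S"
      then have "?u (insert j A) = ?t A (h(j := b j))"
        using insert.hyps by (auto simp: fun_eq_iff)
      then show "cmod (T (?u (insert j A)) x) = cmod (T (?t A (h(j := b j))) x)"
        by (rule arg_cong[of _ _ "\<lambda>u. cmod (T u x)"])
    qed simp
    also have "(\<Sum>A\<in>Pow S. cmod (T (?u A) x)) = (\<Sum>A\<in>Pow S. cmod (T (?t A (h(j := a j))) x))"
    proof (rule sum.cong)
      fix A assume "A \<in> Pow S"
      then have "?u A = ?t A (h(j := a j))"
        using insert.hyps by (auto simp: fun_eq_iff)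
      then show "cmod (T (?u A) x) = cmod (T (?t A (h(j := a j))) x)"
        by (rule arg_cong[of _ _ "\<lambda>u. cmod (T u x)"])
    qed simp
    finally show ?thesis .
  qed
  ultimately show ?case by simp
qed

text \<open>The term with every slot equal to \<open>a\<close> is kept apart as the main term. The
  expansion serves twice: for near and far parts, and for truncations and tails.\<close>

lemma multi_sublinear_expand:
  fixes T :: "('m::finite \<Rightarrow> real ^ 'n \<Rightarrow> complex) \<Rightarrow> real ^ 'n \<Rightarrow> complex"
  assumes T: "multi_sublinear V T" and V: "\<And>i. function_space (V i)"
    and a: "\<And>i. a i \<in> V i" and b: "\<And>i. b i \<in> V i"
  shows "AE x in lborel. ennreal (cmod (T (\<lambda>i y. a i y + b i y) x)) \<le> ennreal (cmod (T a x)) +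
    (\<Sum>A\<in>UNIV - {{}}. ennreal (cmod (T (\<lambda>i. if i \<in> A then b i else a i) x)))"
proof -
  have "AE x in lborel. cmod (T (\<lambda>i y. a i y + b i y) x) \<le>
      (\<Sum>A\<in>UNIV. cmod (T (\<lambda>i. if i \<in> A then b i else a i) x))"
    using multi_sublinear_expand_on[OF T V a b a, of UNIV]
    by (simp add: AE_completion_iff cong: if_cong)
  then show ?thesis
  proof eventually_elim
    case (elim x)
    have "ennreal (cmod (T (\<lambda>i y. a i y + b i y) x)) \<le>
        ennreal (\<Sum>A\<in>UNIV. cmod (T (\<lambda>i. if i \<in> A then b i else a i) x))"
      by (rule ennreal_leI[OF elim])
    also have "\<dots> = (\<Sum>A\<in>UNIV. ennreal (cmod (T (\<lambda>i. if i \<in> A then b i else a i) x)))"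
      by simp
    also have "\<dots> = ennreal (cmod (T a x)) +
        (\<Sum>A\<in>UNIV - {{}}. ennreal (cmod (T (\<lambda>i. if i \<in> A then b i else a i) x)))"
      by (subst sum.remove[of UNIV "{}"]) auto
    finally show ?case .
  qed
qed

text \<open>Bounded pieces of Morrey functions are admissible for both hypotheses on
  \<open>T\<close>: the Morrey norm bounds the local mixed norm, and Hoelder's inequality on a ball
  gives integrability.\<close>

lemma morrey_truncation:
  fixes f :: "(real, 'n::{finite,linorder}) vec \<Rightarrow> complex"
  assumes q: "\<And>j. 1 \<le> q j" and \<phi>: "\<And>x r. 0 < r \<Longrightarrow> 0 < \<phi> x r" and f: "f \<in> morrey_space \<phi> q"
    and E: "E \<in> sets borel" "E \<subseteq> ball 0 R"
  shows "(\<lambda>y. f y * indicator E y) \<in> mixed_Lebesgue (\<lambda>j. ennreal (q j)) \<inter> L1_compact"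
proof -
  have q0: "0 < q j" for j using q[of j] by simp
  \<comment> \<open>\<open>R\<close> may be nonpositive, while the estimates on balls require a
    positive radius.\<close>
  define s where "s = max R 1"
  have s: "0 < s" "E \<subseteq> ball 0 s" using E(2) by (auto simp: s_def)
  have fm [measurable]: "f \<in> borel_measurable lebesgue" and fin: "morrey_norm \<phi> q f < top"
    using f by (auto simp: morrey_space_def)
  have [measurable]: "E \<in> sets lebesgue" using E(1) by (simp add: sets_completionI_sets)
  have meas: "(\<lambda>y. f y * indicator E y) \<in> borel_measurable lebesgue"
    by measurable
  have X: "mixed_ennorm q (\<lambda>y. ennreal (cmod (f y)) * indicator (ball 0 s) y) < top"
    by (rule le_less_trans[OF mixed_ennorm_le_morrey_norm[where q = q and \<phi> = \<phi>, OF q0 s(1) \<phi>[OF s(1)]]])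
       (use fin in \<open>simp add: ennreal_mult_less_top\<close>)
  have "mixed_norm (\<lambda>j. ennreal (q j)) (\<lambda>y. f y * indicator E y) \<le>
      mixed_ennorm q (\<lambda>y. ennreal (cmod (f y)) * indicator (ball 0 s) y)"
    unfolding mixed_norm_times_indicator using s(2) by (intro mixed_ennorm_mono q0) (auto simp: indicator_def)
  then have "(\<lambda>y. f y * indicator E y) \<in> mixed_Lebesgue (\<lambda>j. ennreal (q j))"
    using X meas by (simp add: mixed_Lebesgue_def)
  moreover have "integrable lebesgue (\<lambda>y. f y * indicator E y)"
  proof (rule integrableI_bounded[OF meas])
    have "(\<integral>\<^sup>+ y. ennreal (norm (f y * indicator E y)) \<partial>lebesgue) \<le>
        (\<integral>\<^sup>+ y. ennreal (cmod (f y)) * indicator (ball 0 s) y \<partial>lborel)"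
      unfolding nn_integral_completion using s(2) by (intro nn_integral_mono) (auto simp: indicator_def)
    also have "\<dots> \<le> ennreal (2 ^ CARD('n) * (2 * s) powr (\<Sum>j\<in>UNIV. 1 - 1 / q j)) *
        mixed_ennorm q (\<lambda>y. ennreal (cmod (f y)) * indicator (ball 0 s) y)"
      by (rule mixed_ennorm_Holder_ball[OF q0 q s(1)]) measurable
    also have "\<dots> < \<infinity>"
      using X by (simp add: ennreal_mult_less_top)
    finally show "(\<integral>\<^sup>+ y. ennreal (norm (f y * indicator E y)) \<partial>lebesgue) < \<infinity>" .
  qed
  moreover have "compact (closed_support (\<lambda>y. f y * indicator E y))"
  proof -
    have "{y. f y * indicator E y \<noteq> 0} \<subseteq> ball 0 s"
      using s(2) by (auto simp: indicator_def)
    then have "bounded {y. f y * indicator E y \<noteq> 0}"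
      by (rule bounded_subset[OF bounded_ball])
    then show ?thesis
      unfolding closed_support_def compact_eq_bounded_closed by (blast intro: bounded_closure)
  qed
  ultimately show ?thesis by (simp add: L1_compact_def)
qed

section \<open>Boundedness on Morrey spaces\<close>

lemma ennreal_prod_less_top: "(\<And>i. i \<in> S \<Longrightarrow> f i < top) \<Longrightarrow> (\<Prod>i\<in>S. f i :: ennreal) < top"
  by (induction S rule: infinite_finite_induct) (auto simp: ennreal_mult_less_top)

text \<open>The parameters \<open>C\<close> and \<open>CT\<close> fix the constants of the two
  hypotheses on \<open>T\<close> before any tuple or ball is chosen.\<close>

locale morrey_operator =
  fixes qs :: "'m::finite \<Rightarrow> 'n::{finite,linorder} \<Rightarrow> real"
    and q :: "'n \<Rightarrow> real"
    and \<phi>s :: "'m \<Rightarrow> (real, 'n) vec \<Rightarrow> real \<Rightarrow> real"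
    and V :: "'m \<Rightarrow> ((real, 'n) vec \<Rightarrow> complex) set"
    and T :: "('m \<Rightarrow> (real, 'n) vec \<Rightarrow> complex) \<Rightarrow> (real, 'n) vec \<Rightarrow> complex"
    and C CT :: real
  assumes qs: "\<And>i j. 1 < qs i j"
    and q: "\<And>j. 1 / q j = (\<Sum>i\<in>UNIV. 1 / qs i j)"
    and \<phi>s: "\<And>i x r. 0 < r \<Longrightarrow> 0 < \<phi>s i x r"
    and V: "\<And>i. function_space (V i)"
    and L1_V: "\<And>i. L1_compact \<subseteq> V i"
    and Lebesgue_V: "\<And>i. mixed_Lebesgue (\<lambda>j. ennreal (qs i j)) \<subseteq> V i"
    and morrey_V: "\<And>i. morrey_space (\<phi>s i) (qs i) \<subseteq> V i"
    and sublinear: "multi_sublinear V T"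
    and size: "\<And>f x. (\<forall>i. f i \<in> L1_compact) \<Longrightarrow> x \<notin> (\<Inter>i. closed_support (f i)) \<Longrightarrow>
      ennreal (cmod (T f x)) \<le>
        ennreal C * (\<integral>\<^sup>+ y. ennreal ((\<Prod>i\<in>UNIV. cmod (f i (y $ i))) /
          norm (\<chi> i. x - y $ i) ^ (CARD('m) * CARD('n))) \<partial>(lebesgue :: (((real, 'n) vec, 'm) vec) measure))"
    and bounded: "\<And>f. (\<forall>i. f i \<in> mixed_Lebesgue (\<lambda>j. ennreal (qs i j))) \<Longrightarrow>
      mixed_norm (\<lambda>j. ennreal (q j)) (T f) \<le>
        ennreal CT * (\<Prod>i\<in>UNIV. mixed_norm (\<lambda>j. ennreal (qs i j)) (f i))"
    and trunc: "\<And>f. \<lbrakk>\<forall>i. f i \<in> morrey_space (\<phi>s i) (qs i);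
        \<exists>i. f i \<notin> mixed_Lebesgue (\<lambda>j. ennreal (qs i j))\<rbrakk> \<Longrightarrow> truncation_controlled T f"
begin

lemma qs_pos: "0 < qs i j" and qs_ge: "1 \<le> qs i j"
  using qs[of i j] by simp_all

text \<open>Since \<open>1 / 0 = 0\<close>, positivity of the sum of reciprocals excludes zero as
  well as negative values.\<close>

lemma q_pos: "0 < q j"
proof -
  have "0 < (\<Sum>i\<in>UNIV. 1 / qs i j)"
    using qs_pos by (intro sum_pos) auto
  then show ?thesis using q[of j] by (metis zero_less_divide_1_iff)
qed

lemma measurable_T: "(\<And>i. f i \<in> V i) \<Longrightarrow> (\<lambda>x. ennreal (cmod (T f x))) \<in> borel_measurable lebesgue"
proof -
  assume "\<And>i. f i \<in> V i"
  then have [measurable]: "T f \<in> borel_measurable lebesgue"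
    using sublinear unfolding multi_sublinear_def by blast
  show ?thesis by measurable
qed

text \<open>The same product bounds the term of every nonempty set of far slots, so the sum only
  costs the number of these sets. It is centred at \<open>x\<close> and hence constant on the
  ball.\<close>

abbreviation far_bound :: "('m \<Rightarrow> (real, 'n) vec \<Rightarrow> complex) \<Rightarrow> (real, 'n) vec \<Rightarrow> real \<Rightarrow> ennreal" where
  "far_bound f x r \<equiv> of_nat (card (UNIV - {{}} :: 'm set set)) * (ennreal C * (\<Prod>i\<in>UNIV. ennreal (2 ^ CARD('n)) *
    (\<integral>\<^sup>+ v. ennreal (cmod (f i v)) * ennreal (1 / max r (dist x v) ^ CARD('n)) \<partial>lborel)))"

text \<open>The right-hand side does not involve \<open>R\<close>; this uniformity is what survives
  the limit of the truncations.\<close>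

lemma AE_near_far:
  assumes f: "\<And>i. f i \<in> morrey_space (\<phi>s i) (qs i)" and r: "0 < r" and R: "ball x (2 * r) \<subseteq> ball 0 R"
  shows "AE y in lborel. y \<in> ball x r \<longrightarrow>
    ennreal (cmod (T (\<lambda>i y. f i y * indicator (ball 0 R) y) y)) \<le>
    ennreal (cmod (T (\<lambda>i y. f i y * indicator (ball x (2 * r)) y) y)) + far_bound f x r"
proof -
  define a where "a i y = f i y * indicator (ball x (2 * r)) y" for i y
  define b where "b i y = f i y * indicator (ball 0 R - ball x (2 * r)) y" for i y
  have a: "a i \<in> L1_compact" and b: "b i \<in> L1_compact" for i
    using morrey_truncation[OF qs_ge \<phi>s f, where R = R] R
    unfolding a_def[abs_def] b_def[abs_def] by (simp_all add: Diff_subset)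
  have ab: "(\<lambda>i y. f i y * indicator (ball 0 R) y) = (\<lambda>i y. a i y + b i y)"
    using R by (auto simp: a_def b_def fun_eq_iff indicator_def)
  have fm: "f i \<in> borel_measurable lebesgue" for i
    using f[of i] by (simp add: morrey_space_def)
  have "AE y in lborel. ennreal (cmod (T (\<lambda>i y. a i y + b i y) y)) \<le> ennreal (cmod (T a y)) +
      (\<Sum>A\<in>UNIV - {{}}. ennreal (cmod (T (\<lambda>i. if i \<in> A then b i else a i) y)))"
    by (rule multi_sublinear_expand[OF sublinear V]) (use a b L1_V in blast)+
  then show ?thesis
    unfolding ab
  proof eventually_elim
    case (elim y)
    show ?case
    proof
      assume y: "y \<in> ball x r"
      have "(\<Sum>A\<in>UNIV - {{}}. ennreal (cmod (T (\<lambda>i. if i \<in> A then b i else a i) y))) \<le> far_bound f x r"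
      proof (rule sum_bounded_above)
        fix A :: "'m set" assume "A \<in> UNIV - {{}}"
        then obtain k where k: "k \<in> A" by auto
        show "ennreal (cmod (T (\<lambda>i. if i \<in> A then b i else a i) y)) \<le>
            ennreal C * (\<Prod>i\<in>UNIV. ennreal (2 ^ CARD('n)) *
              (\<integral>\<^sup>+ v. ennreal (cmod (f i v)) * ennreal (1 / max r (dist x v) ^ CARD('n)) \<partial>lborel))"
        proof (rule size_bound[where g = "\<lambda>i. if i \<in> A then b i else a i" and k = k, OF size r y _ fm])
          show "(if i \<in> A then b i else a i) \<in> L1_compact" for i
            using a b by simp
          show "cmod ((if i \<in> A then b i else a i) v) \<le> cmod (f i v)" for i v
            by (simp add: a_def b_def indicator_def)
          show "(if k \<in> A then b k else a k) v = 0" if "v \<in> ball x (2 * r)" for v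
            using k that by (simp add: b_def)
        qed
      qed
      then show "ennreal (cmod (T (\<lambda>i y. a i y + b i y) y)) \<le>
          ennreal (cmod (T (\<lambda>i y. f i y * indicator (ball x (2 * r)) y) y)) + far_bound f x r"
        using elim by (auto simp: a_def[abs_def] intro: order_trans add_left_mono)
    qed
  qed
qed

text \<open>A slot in \<open>A\<close> carries a tail, whose norm tends to zero, while the norms in
  the other slots stay below those of the full arguments.\<close>

lemma tail_tendsto_0:
  assumes f: "\<And>i. f i \<in> mixed_Lebesgue (\<lambda>j. ennreal (qs i j))" and A: "A \<noteq> {}"
  shows "(\<lambda>N. mixed_ennorm q (\<lambda>y. ennreal (cmod (T (\<lambda>i. if i \<in> A
    then (\<lambda>y. f i y * indicator (- ball 0 (real N)) y) else (\<lambda>y. f i y * indicator (ball 0 (real N)) y)) y))))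
    \<longlonglongrightarrow> 0"
proof -
  obtain k where k: "k \<in> A" using A by auto
  let ?F = "\<lambda>i y. ennreal (cmod (f i y))"
  have fm [measurable]: "f i \<in> borel_measurable lebesgue" and fin: "mixed_ennorm (qs i) (?F i) < top" for i
    using f[of i] by (simp_all add: mixed_Lebesgue_def mixed_norm_eq_mixed_ennorm)
  define g where "g N i = (if i \<in> A
    then (\<lambda>y. f i y * indicator (- ball 0 (real N)) y) else (\<lambda>y. f i y * indicator (ball 0 (real N)) y))" for N i
  have g_le: "mixed_norm (\<lambda>j. ennreal (qs i j)) (g N i) \<le> mixed_ennorm (qs i) (?F i)" for N i
    unfolding mixed_norm_eq_mixed_ennorm
    by (intro mixed_ennorm_mono qs_pos) (simp add: g_def indicator_def)
  have "g N i \<in> mixed_Lebesgue (\<lambda>j. ennreal (qs i j))" for N i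
  proof -
    have "ball 0 (real N) \<in> sets (lebesgue :: (real, 'n) vec measure)"
      by (simp add: sets_completionI_sets)
    then have "(\<lambda>y. f i y * indicator (ball 0 (real N)) y) \<in> borel_measurable lebesgue"
      "(\<lambda>y. f i y * indicator (- ball 0 (real N)) y) \<in> borel_measurable lebesgue"
      by measurable
    then have "g N i \<in> borel_measurable lebesgue"
      by (simp add: g_def)
    then show ?thesis
      using le_less_trans[OF g_le[of i N] fin[of i]] by (simp add: mixed_Lebesgue_def)
  qed
  then have "mixed_norm (\<lambda>j. ennreal (q j)) (T (g N)) \<le>
      ennreal CT * (\<Prod>i\<in>UNIV. mixed_norm (\<lambda>j. ennreal (qs i j)) (g N i))" for N
    by (intro bounded) auto
  moreover have "(\<Prod>i\<in>UNIV. mixed_norm (\<lambda>j. ennreal (qs i j)) (g N i)) \<le>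
      mixed_ennorm (qs k) (\<lambda>y. ?F k y * indicator (- ball 0 (real N)) y) *
      (\<Prod>i\<in>UNIV - {k}. mixed_ennorm (qs i) (?F i))" for N
  proof -
    have "mixed_norm (\<lambda>j. ennreal (qs k j)) (g N k) =
        mixed_ennorm (qs k) (\<lambda>y. ?F k y * indicator (- ball 0 (real N)) y)"
      using k by (simp add: g_def mixed_norm_times_indicator)
    then show ?thesis
      by (subst prod.remove[of UNIV k]) (auto intro!: mult_left_mono prod_mono_ennreal g_le)
  qed
  ultimately have le: "mixed_norm (\<lambda>j. ennreal (q j)) (T (g N)) \<le>
      (ennreal CT * (\<Prod>i\<in>UNIV - {k}. mixed_ennorm (qs i) (?F i))) *
      mixed_ennorm (qs k) (\<lambda>y. ?F k y * indicator (- ball 0 (real N)) y)" for N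
    by (rule order_trans[OF _ order_trans[OF mult_left_mono]]) (auto simp: mult_ac)
  have "(\<lambda>N. mixed_ennorm (qs k) (\<lambda>y. ?F k y * indicator (- ball 0 (real N)) y)) \<longlonglongrightarrow> 0"
    by (rule mixed_ennorm_tail_tendsto_0[OF qs_pos _ fin]) measurable
  then have "(\<lambda>N. (ennreal CT * (\<Prod>i\<in>UNIV - {k}. mixed_ennorm (qs i) (?F i))) *
      mixed_ennorm (qs k) (\<lambda>y. ?F k y * indicator (- ball 0 (real N)) y)) \<longlonglongrightarrow>
      (ennreal CT * (\<Prod>i\<in>UNIV - {k}. mixed_ennorm (qs i) (?F i))) * 0"
    by (intro ennreal_tendsto_cmult) (auto simp: ennreal_mult_less_top intro!: ennreal_prod_less_top fin)
  then have lim: "(\<lambda>N. (ennreal CT * (\<Prod>i\<in>UNIV - {k}. mixed_ennorm (qs i) (?F i))) *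
      mixed_ennorm (qs k) (\<lambda>y. ?F k y * indicator (- ball 0 (real N)) y)) \<longlonglongrightarrow> 0"
    by (simp only: mult_zero_right)
  have "(\<lambda>N. mixed_norm (\<lambda>j. ennreal (q j)) (T (g N))) \<longlonglongrightarrow> 0"
    using le by (intro tendsto_sandwich[OF _ _ tendsto_const lim]) auto
  then show ?thesis
    by (simp add: mixed_norm_eq_mixed_ennorm g_def[abs_def])
qed

text \<open>Where truncation control is not assumed, all arguments lie in mixed Lebesgue spaces and the
  truncation error tends to zero in norm.\<close>

lemma mixed_ennorm_ball_T_le:
  "\<exists>K<top. \<forall>f x r. (\<forall>i. f i \<in> morrey_space (\<phi>s i) (qs i)) \<longrightarrow> 0 < r \<longrightarrow>
    mixed_ennorm q (\<lambda>y. ennreal (cmod (T f y)) * indicator (ball x r) y) \<le>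
    K * (mixed_norm (\<lambda>j. ennreal (q j)) (T (\<lambda>i y. f i y * indicator (ball x (2 * r)) y)) +
      far_bound f x r * mixed_ennorm q (indicator (ball x r)))"
proof -
  obtain K' where K': "\<And>F G. F \<in> borel_measurable lebesgue \<Longrightarrow> G \<in> borel_measurable lebesgue \<Longrightarrow>
      mixed_ennorm q (\<lambda>x. F x + G x) \<le> ennreal K' * (mixed_ennorm q F + mixed_ennorm q G)"
    using mixed_ennorm_add[of q, OF q_pos] by blast
  \<comment> \<open>With \<open>K\<close> at least one, the case under truncation control, where no
    error term arises, fits the same bound.\<close>
  define K where "K = max 1 (ennreal K')"
  have K: "mixed_ennorm q (\<lambda>x. F x + G x) \<le> K * (mixed_ennorm q F + mixed_ennorm q G)"
    if "F \<in> borel_measurable lebesgue" "G \<in> borel_measurable lebesgue" for F G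
    using K'[OF that] by (rule order_trans) (simp add: K_def mult_right_mono)
  have K_top: "K < top" by (simp add: K_def)
  have K_ge: "1 \<le> K" by (simp add: K_def)
  \<comment> \<open>The quasi-triangle inequality is used twice: to remove the truncation error, and
    to separate the near from the far contribution.\<close>
  have "mixed_ennorm q (\<lambda>y. ennreal (cmod (T f y)) * indicator (ball x r) y) \<le>
      (K * K) * (mixed_norm (\<lambda>j. ennreal (q j)) (T (\<lambda>i y. f i y * indicator (ball x (2 * r)) y)) +
        far_bound f x r * mixed_ennorm q (indicator (ball x r)))"
    if f: "\<And>i. f i \<in> morrey_space (\<phi>s i) (qs i)" and r: "0 < r" for f x r
  proof -
    let ?X = "mixed_ennorm q (\<lambda>y. ennreal (cmod (T f y)) * indicator (ball x r) y)"
    let ?fN = "\<lambda>N i y. f i y * indicator (ball 0 (real N)) y"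
    define near where "near i y = f i y * indicator (ball x (2 * r)) y" for i y
    define P where "P = far_bound f x r"
    define G where "G y = ennreal (cmod (T near y)) * indicator (ball x r) y + P * indicator (ball x r) y" for y
    have ball_meas [measurable]: "ball z s \<in> sets lebesgue" for z :: "(real, 'n) vec" and s
      by (simp add: sets_completionI_sets)
    obtain N0 :: nat where "norm x + 2 * r \<le> real N0"
      using real_arch_simple by blast
    then have sub: "ball x (2 * r) \<subseteq> ball 0 (real N)" if "N0 \<le> N" for N
    proof -
      have "norm x + 2 * r \<le> real N" using \<open>norm x + 2 * r \<le> real N0\<close> that by linarith
      then show ?thesis
        by (auto simp: dist_norm) (smt (verit) norm_triangle_sub norm_minus_commute)
    qed
    have near_V: "near i \<in> V i" for i
      using morrey_truncation[OF qs_ge \<phi>s f _ sub[of N0]] L1_V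
      unfolding near_def[abs_def] by auto
    have near_meas [measurable]: "(\<lambda>y. ennreal (cmod (T near y))) \<in> borel_measurable lebesgue"
      by (rule measurable_T[OF near_V])
    have G_meas [measurable]: "G \<in> borel_measurable lebesgue" unfolding G_def by measurable
    \<comment> \<open>There are only countably many radii \<open>N\<close>, so one null set serves
      all of them.\<close>
    have trunc_le: "AE y in lborel. \<forall>N\<ge>N0. ennreal (cmod (T (?fN N) y)) * indicator (ball x r) y \<le> G y"
    proof -
      have "AE y in lborel. N0 \<le> N \<longrightarrow> ennreal (cmod (T (?fN N) y)) * indicator (ball x r) y \<le> G y" for N
        using AE_near_far[OF f r sub, of N]
        by (cases "N0 \<le> N") (auto elim!: eventually_mono simp: G_def P_def near_def[abs_def] indicator_def)
      then show ?thesis by (simp add: AE_all_countable)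
    qed
    have "?X \<le> K * mixed_ennorm q G"
    proof (cases "\<exists>i. f i \<notin> mixed_Lebesgue (\<lambda>j. ennreal (qs i j))")
      case True
      then have "AE y in lborel. ennreal (cmod (T f y)) \<le> liminf (\<lambda>N. ennreal (cmod (T (?fN N) y)))"
        using trunc f unfolding truncation_controlled_def by (simp add: AE_completion_iff)
      with trunc_le have "AE y in lborel. ennreal (cmod (T f y)) * indicator (ball x r) y \<le> G y"
      proof eventually_elim
        case (elim y)
        show ?case
        proof (cases "y \<in> ball x r")
          case True
          have "liminf (\<lambda>N. ennreal (cmod (T (?fN N) y))) \<le> liminf (\<lambda>N. G y)"
            using elim(1) True by (intro Liminf_mono eventually_sequentiallyI[of N0]) auto
          then show ?thesis
            using elim(2) True by (simp add: Liminf_const)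
        qed simp
      qed
      then have "?X \<le> 1 * mixed_ennorm q G"
        using mixed_ennorm_mono_AE[of q, OF q_pos] by simp
      also have "\<dots> \<le> K * mixed_ennorm q G"
        using K_ge by (rule mult_right_mono) simp
      finally show ?thesis .
    next
      case False
      then have fL: "f i \<in> mixed_Lebesgue (\<lambda>j. ennreal (qs i j))" for i by auto
      let ?t = "\<lambda>A N i. if i \<in> A then (\<lambda>y. f i y * indicator (- ball 0 (real N)) y) else ?fN N i"
      define R where "R N y = (\<Sum>A\<in>UNIV - {{}}. ennreal (cmod (T (?t A N) y)))" for N y
      \<comment> \<open>A tail is the function minus its truncation, so linearity of
        \<open>V i\<close> applies, although the tail has no compact support.\<close>
      have tail_V: "(\<lambda>y. f i y * indicator (- ball 0 (real N)) y) \<in> V i"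
        and trunc_V: "?fN N i \<in> V i" for i N
      proof -
        have fN: "?fN N i \<in> V i"
          using morrey_truncation[OF qs_ge \<phi>s f, where R = "real N" and E = "ball 0 (real N)"] L1_V by auto
        then show "?fN N i \<in> V i" .
        have V_cmult: "(\<lambda>y. c * g y) \<in> V i" if "g \<in> V i" for g c
          using V[of i] that by (simp add: function_space_def)
        have V_add: "(\<lambda>y. g y + h y) \<in> V i" if "g \<in> V i" "h \<in> V i" for g h
          using V[of i] that by (simp add: function_space_def)
        have "(\<lambda>y. f i y + (- 1) * ?fN N i y) \<in> V i"
          by (intro V_add V_cmult fN) (use f[of i] morrey_V[of i] in auto)
        moreover have "(\<lambda>y. f i y + (- 1) * ?fN N i y) = (\<lambda>y. f i y * indicator (- ball 0 (real N)) y)"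
          by (auto simp: fun_eq_iff indicator_def)
        ultimately show "(\<lambda>y. f i y * indicator (- ball 0 (real N)) y) \<in> V i" by simp
      qed
      have t_meas: "(\<lambda>y. ennreal (cmod (T (?t A N) y))) \<in> borel_measurable lebesgue" for A N
        by (rule measurable_T) (use tail_V trunc_V in auto)
      have R_meas: "R N \<in> borel_measurable lebesgue" for N
        unfolding R_def by (intro borel_measurable_sum t_meas)
      have R_lim: "(\<lambda>N. mixed_ennorm q (R N)) \<longlonglongrightarrow> 0"
      proof -
        obtain Ks where Ks: "\<And>F. (\<forall>A\<in>UNIV - {{}}. F A \<in> borel_measurable lebesgue) \<Longrightarrow>
            mixed_ennorm q (\<lambda>x. \<Sum>A\<in>UNIV - {{} :: 'm set}. F A x) \<le>
            ennreal Ks * (\<Sum>A\<in>UNIV - {{}}. mixed_ennorm q (F A))"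
          using mixed_ennorm_sum[of q "UNIV - {{} :: 'm set}", OF q_pos] by auto
        have "(\<lambda>N. ennreal Ks * (\<Sum>A\<in>UNIV - {{}}. mixed_ennorm q (\<lambda>y. ennreal (cmod (T (?t A N) y)))))
            \<longlonglongrightarrow> ennreal Ks * (\<Sum>A\<in>UNIV - {{} :: 'm set}. 0)"
          by (intro ennreal_tendsto_cmult tendsto_sum tail_tendsto_0 fL) auto
        then have lim: "(\<lambda>N. ennreal Ks * (\<Sum>A\<in>UNIV - {{}}. mixed_ennorm q (\<lambda>y. ennreal (cmod (T (?t A N) y)))))
            \<longlonglongrightarrow> 0"
          by simp
        have "mixed_ennorm q (R N) \<le>
            ennreal Ks * (\<Sum>A\<in>UNIV - {{}}. mixed_ennorm q (\<lambda>y. ennreal (cmod (T (?t A N) y))))" for N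
          unfolding R_def by (intro Ks ballI t_meas)
        then show ?thesis
          by (intro tendsto_sandwich[OF _ _ tendsto_const lim]) auto
      qed
      \<comment> \<open>The left-hand side is free of \<open>N\<close>, so letting \<open>N\<close>
        tend to infinity removes the error term.\<close>
      have "?X \<le> K * mixed_ennorm q G + K * mixed_ennorm q (R N)" if N: "N0 \<le> N" for N
      proof -
        have "(\<lambda>i y. ?fN N i y + f i y * indicator (- ball 0 (real N)) y) = f"
          by (auto simp: fun_eq_iff indicator_def)
        then have "AE y in lborel. ennreal (cmod (T f y)) \<le> ennreal (cmod (T (?fN N) y)) + R N y"
          using multi_sublinear_expand[OF sublinear V, of "?fN N" "\<lambda>i y. f i y * indicator (- ball 0 (real N)) y",
              OF trunc_V tail_V]
          by (simp add: R_def)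
        with trunc_le have "AE y in lborel. ennreal (cmod (T f y)) * indicator (ball x r) y \<le> G y + R N y"
        proof eventually_elim
          case (elim y)
          then show ?case
            using N by (cases "y \<in> ball x r") (auto intro: order_trans add_right_mono)
        qed
        then have "?X \<le> mixed_ennorm q (\<lambda>y. G y + R N y)"
          by (rule mixed_ennorm_mono_AE[of q, OF q_pos])
        also have "\<dots> \<le> K * (mixed_ennorm q G + mixed_ennorm q (R N))"
          by (rule K[OF G_meas R_meas])
        finally show ?thesis by (simp add: distrib_left)
      qed
      moreover have "(\<lambda>N. K * mixed_ennorm q G + K * mixed_ennorm q (R N)) \<longlonglongrightarrow> K * mixed_ennorm q G + K * 0"
        using K_top by (intro tendsto_add tendsto_const ennreal_tendsto_cmult R_lim) auto
      ultimately show ?thesis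
        by (intro LIMSEQ_le_const[where x = "K * mixed_ennorm q G"]) auto
    qed
    also have "mixed_ennorm q G \<le> K * (mixed_ennorm q (\<lambda>y. ennreal (cmod (T near y)) * indicator (ball x r) y) +
        mixed_ennorm q (\<lambda>y. P * indicator (ball x r) y))"
      unfolding G_def by (rule K) measurable
    also have "mixed_ennorm q (\<lambda>y. P * indicator (ball x r) y) = P * mixed_ennorm q (indicator (ball x r))"
      by (rule mixed_ennorm_cmult[of q, OF q_pos]) measurable
    also have "mixed_ennorm q (\<lambda>y. ennreal (cmod (T near y)) * indicator (ball x r) y) \<le>
        mixed_norm (\<lambda>j. ennreal (q j)) (T near)"
      unfolding mixed_norm_eq_mixed_ennorm by (intro mixed_ennorm_mono q_pos) (auto simp: indicator_def)
    finally show ?thesis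
      by (simp add: mult.assoc mult_left_mono add_right_mono near_def[abs_def] P_def)
  qed
  moreover have "K * K < top" using K_top by (simp add: ennreal_mult_less_top)
  ultimately show ?thesis by blast
qed

text \<open>The powers of \<open>8 * r\<close> from the single slots multiply to the exponent
  belonging to \<open>q\<close>, which is the size of the norm of the indicator of the ball.
  Dividing by that norm leaves the product of the weight integrals, which
  \<open>\<phi>s_\<phi>\<close> compares with \<open>\<phi> x r\<close>.\<close>

lemma morrey_norm_T_le:
  assumes C0: "0 < C0" and \<phi>: "\<And>x r. 0 < r \<Longrightarrow> 0 < \<phi> x r"
    and \<phi>s_\<phi>: "\<And>x r. 0 < r \<Longrightarrow>
      (\<Prod>i\<in>UNIV. \<integral>\<^sup>+ t\<in>{r<..}. ennreal (\<phi>s i x t / t) \<partial>lebesgue) \<le> ennreal (C0 * \<phi> x r)"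
  shows "\<exists>K<top. \<forall>f. (\<forall>i. f i \<in> morrey_space (\<phi>s i) (qs i)) \<longrightarrow>
    morrey_norm \<phi> q (T f) \<le> K * (\<Prod>i\<in>UNIV. morrey_norm (\<phi>s i) (qs i) (f i))"
proof -
  let ?n = "CARD('n)" and ?m = "CARD('m)"
  let ?S = "\<Sum>j\<in>UNIV. 1 / q j" and ?Si = "\<lambda>i. \<Sum>j\<in>UNIV. 1 / qs i j"
  obtain K where K: "K < top" "\<And>f x r. (\<And>i. f i \<in> morrey_space (\<phi>s i) (qs i)) \<Longrightarrow> 0 < r \<Longrightarrow>
      mixed_ennorm q (\<lambda>y. ennreal (cmod (T f y)) * indicator (ball x r) y) \<le>
      K * (mixed_norm (\<lambda>j. ennreal (q j)) (T (\<lambda>i y. f i y * indicator (ball x (2 * r)) y)) +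
        far_bound f x r * mixed_ennorm q (indicator (ball x r)))"
    using mixed_ennorm_ball_T_le by blast
  have S: "(\<Sum>i\<in>UNIV. ?Si i) = ?S"
    unfolding q by (rule sum.swap)
  have S_nonneg: "0 \<le> ?S"
    using q_pos by (intro sum_nonneg) (simp add: less_imp_le)
  \<comment> \<open>Each slot contributes 2 to the near term; to the far term it contributes
    \<open>2 ^ ?n\<close> from the size bound and \<open>2 * 8 ^ ?n\<close> from the layered
    kernel.\<close>
  define kn where "kn = ennreal CT * ennreal (2 ^ ?m)"
  define kf where "kf = of_nat (card (UNIV - {{}} :: 'm set set)) *
    (ennreal C * ennreal ((2 ^ ?n * (2 * 8 ^ ?n)) ^ ?m))"
  define k where "k = K * (kn + kf) * ennreal ((8 * ?n) powr ?S) * ennreal C0"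
  have k: "k < top"
  proof -
    have "of_nat n < (top :: ennreal)" for n
      by (simp add: of_nat_less_top)
    then have "kf < top"
      unfolding kf_def ennreal_mult_less_top by simp
    then show ?thesis
      using K(1) by (simp add: k_def kn_def ennreal_mult_less_top)
  qed
  have "morrey_norm \<phi> q (T f) \<le> k * (\<Prod>i\<in>UNIV. morrey_norm (\<phi>s i) (qs i) (f i))"
    if f: "\<And>i. f i \<in> morrey_space (\<phi>s i) (qs i)" for f
  proof -
    let ?M = "\<lambda>i. morrey_norm (\<phi>s i) (qs i) (f i)"
    have fm: "f i \<in> borel_measurable lebesgue" and fin: "?M i < top" for i
      using f[of i] by (simp_all add: morrey_space_def)
    have "inverse (ennreal (\<phi> x r)) * inverse (mixed_ennorm q (indicator (ball x r))) *
        mixed_ennorm q (\<lambda>y. ennreal (cmod (T f y)) * indicator (ball x r) y) \<le> k * (\<Prod>i\<in>UNIV. ?M i)"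
      (is "_ * inverse ?\<nu> * ?X \<le> _") if r: "0 < r" for x r
    proof -
      let ?\<Phi> = "\<lambda>i. \<integral>\<^sup>+ t\<in>{r<..}. ennreal (\<phi>s i x t / t) \<partial>lebesgue"
      define W where "W = (\<Prod>i\<in>UNIV. ?M i * ?\<Phi> i)"
      define p where "p = ennreal ((8 * r) powr ?S)"
      have "mixed_norm (\<lambda>j. ennreal (q j)) (T (\<lambda>i y. f i y * indicator (ball x (2 * r)) y)) \<le>
          ennreal CT * (\<Prod>i\<in>UNIV. mixed_ennorm (qs i) (\<lambda>y. ennreal (cmod (f i y)) * indicator (ball x (2 * r)) y))"
      proof -
        have "(\<lambda>y. f i y * indicator (ball x (2 * r)) y) \<in> mixed_Lebesgue (\<lambda>j. ennreal (qs i j))" for i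
        proof -
          obtain s where "ball x (2 * r) \<subseteq> ball 0 s"
            using bounded_subset_ballD[OF bounded_ball] by blast
          then show ?thesis
            using morrey_truncation[OF qs_ge \<phi>s f, where E = "ball x (2 * r)" and R = s] by auto
        qed
        then show ?thesis
          using bounded[of "\<lambda>i y. f i y * indicator (ball x (2 * r)) y"] by (simp add: mixed_norm_times_indicator)
      qed
      also have "\<dots> \<le> ennreal CT * (\<Prod>i\<in>UNIV. ennreal (2 * (8 * r) powr ?Si i) * (?M i * ?\<Phi> i))"
        by (intro mult_left_mono prod_mono_ennreal mixed_ennorm_near_le qs_pos r \<phi>s fin) auto
      also have "\<dots> = kn * p * W"
      proof -
        have "(\<Prod>i\<in>UNIV. ennreal (2 * (8 * r) powr ?Si i)) = ennreal (\<Prod>i\<in>UNIV. 2 * (8 * r) powr ?Si i)"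
          by (rule prod_ennreal) simp
        also have "(\<Prod>i\<in>UNIV. 2 * (8 * r) powr ?Si i) = 2 ^ ?m * (8 * r) powr ?S"
          using r by (simp add: prod.distrib powr_sum[symmetric] S)
        also have "ennreal \<dots> = ennreal (2 ^ ?m) * p"
          by (simp add: ennreal_mult p_def)
        finally show ?thesis
          by (simp add: prod.distrib W_def kn_def mult.assoc)
      qed
      finally have near: "mixed_norm (\<lambda>j. ennreal (q j)) (T (\<lambda>i y. f i y * indicator (ball x (2 * r)) y)) \<le>
          kn * p * W" .
      have far: "far_bound f x r \<le> kf * W"
      proof -
        have "(\<Prod>i\<in>UNIV. ennreal (2 ^ ?n) * (\<integral>\<^sup>+ v. ennreal (cmod (f i v)) *
              ennreal (1 / max r (dist x v) ^ ?n) \<partial>lborel)) \<le>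
            (\<Prod>i\<in>UNIV. ennreal (2 ^ ?n) * (ennreal (2 * 8 ^ ?n) * (?M i * ?\<Phi> i)))"
          by (intro prod_mono_ennreal mult_left_mono nn_integral_far_le qs_pos qs_ge r \<phi>s fm fin) auto
        also have "\<dots> = ennreal ((2 ^ ?n * (2 * 8 ^ ?n)) ^ ?m) * W"
          by (simp add: prod.distrib W_def ennreal_power[symmetric] ennreal_mult power_mult_distrib mult.assoc)
        finally show ?thesis
          by (simp add: kf_def mult.assoc mult_left_mono)
      qed
      \<comment> \<open>\<open>p\<close> and \<open>?\<nu>\<close> are comparable: the upper bound
        gives the far term the factor \<open>p\<close> of the near term, the lower bound then trades
        \<open>p\<close> back for \<open>?\<nu>\<close>, which cancels.\<close>
      have "?\<nu> \<le> ennreal ((2 * r) powr ?S)"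
        by (rule mixed_ennorm_ball_le[OF q_pos r])
      also have "\<dots> \<le> p"
        unfolding p_def using r S_nonneg by (intro ennreal_leI powr_mono2) auto
      finally have \<nu>p: "?\<nu> \<le> p" .
      have p\<nu>: "p \<le> ennreal ((8 * ?n) powr ?S) * ?\<nu>"
      proof -
        have "(8 * r) powr ?S = (8 * ?n) powr ?S * (r / ?n) powr ?S"
          using r by (subst powr_mult[symmetric]) auto
        then have "p = ennreal ((8 * ?n) powr ?S) * ennreal ((r / ?n) powr ?S)"
          by (simp add: p_def ennreal_mult)
        also have "\<dots> \<le> ennreal ((8 * ?n) powr ?S) * ?\<nu>"
          by (intro mult_left_mono mixed_ennorm_ball_ge q_pos r) simp
        finally show ?thesis .
      qed
      have W: "W \<le> (\<Prod>i\<in>UNIV. ?M i) * (ennreal C0 * ennreal (\<phi> x r))"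
        using \<phi>s_\<phi>[OF r, of x] C0 \<phi>[OF r, of x] unfolding W_def prod.distrib
        by (intro mult_left_mono) (simp_all add: ennreal_mult less_imp_le)
      have "?X \<le> K * (kn * p * W + (kf * W) * p)"
        by (rule order_trans[OF K(2)[OF f r]]) (intro mult_left_mono add_mono mult_mono near far \<nu>p; simp)
      also have "\<dots> = K * (kn + kf) * p * W"
        by (simp add: algebra_simps)
      also have "\<dots> \<le> K * (kn + kf) * (ennreal ((8 * ?n) powr ?S) * ?\<nu>) *
          ((\<Prod>i\<in>UNIV. ?M i) * (ennreal C0 * ennreal (\<phi> x r)))"
        by (intro mult_mono order_refl p\<nu> W) auto
      also have "\<dots> = ennreal (\<phi> x r) * ?\<nu> * (k * (\<Prod>i\<in>UNIV. ?M i))"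
        by (simp add: k_def mult_ac)
      finally have "inverse (ennreal (\<phi> x r)) * inverse ?\<nu> * ?X \<le>
          inverse (ennreal (\<phi> x r)) * inverse ?\<nu> * (ennreal (\<phi> x r) * ?\<nu> * (k * (\<Prod>i\<in>UNIV. ?M i)))"
        by (intro mult_left_mono) auto
      also have "\<dots> = (inverse (ennreal (\<phi> x r)) * ennreal (\<phi> x r)) * (inverse ?\<nu> * ?\<nu>) * (k * (\<Prod>i\<in>UNIV. ?M i))"
        by (simp add: mult_ac)
      also have "inverse (ennreal (\<phi> x r)) * ennreal (\<phi> x r) = 1"
        using \<phi>[OF r] by (intro ennreal_inverse_mult_self) auto
      also have "inverse ?\<nu> * ?\<nu> = 1"
        by (intro ennreal_inverse_mult_self mixed_ennorm_ball_pos mixed_ennorm_ball_finite q_pos r)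
      finally show ?thesis by simp
    qed
    then show ?thesis
      unfolding morrey_norm_def[of \<phi>] mixed_norm_times_indicator mixed_norm_of_indicator
      by (auto intro!: SUP_least)
  qed
  then show ?thesis using k by blast
qed

end

theorem theorem3p1:
  fixes qs :: "'m::finite \<Rightarrow> 'n::{finite,linorder} \<Rightarrow> real"
    and q :: "'n \<Rightarrow> real"
    and \<phi>s :: "'m \<Rightarrow> real ^ 'n::{finite,linorder} \<Rightarrow> real \<Rightarrow> real"
    and \<phi> :: "real ^ 'n::{finite,linorder} \<Rightarrow> real \<Rightarrow> real"
    and C0 :: real
    and V :: "'m \<Rightarrow> (real ^ 'n::{finite,linorder} \<Rightarrow> complex) set"
    and T :: "('m \<Rightarrow> real ^ 'n::{finite,linorder} \<Rightarrow> complex) \<Rightarrow> real ^ 'n::{finite,linorder} \<Rightarrow> complex"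
  assumes m: "CARD('m) \<ge> 2"
    and qs: "\<And>i j. 1 < qs i j"
    and q: "\<And>j. 1 / q j = (\<Sum>i\<in>UNIV. 1 / qs i j)"
    and \<phi>: "morrey_weight \<phi>"
    and \<phi>s: "\<And>i. morrey_weight (\<phi>s i)"
    and C0: "C0 > 0"
    and \<phi>s_\<phi>: "\<And>x r. r > 0 \<Longrightarrow>
      (\<Prod>i\<in>UNIV. \<integral>\<^sup>+ t\<in>{r<..}. ennreal (\<phi>s i x t / t) \<partial>lebesgue) \<le> ennreal (C0 * \<phi> x r)"
    and V: "\<And>i. function_space (V i)"
      "\<And>i. L1_compact \<subseteq> V i"
      "\<And>i. mixed_Lebesgue (\<lambda>j. ennreal (qs i j)) \<subseteq> V i"
      "\<And>i. morrey_space (\<phi>s i) (qs i) \<subseteq> V i"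
    and T_sublinear: "multi_sublinear V T"
    and T_size: "size_condition T"
    and T_Lebesgue: "bounded_multi T
      (\<lambda>i. mixed_Lebesgue (\<lambda>j. ennreal (qs i j))) (\<lambda>i. mixed_norm (\<lambda>j. ennreal (qs i j)))
      (mixed_Lebesgue (\<lambda>j. ennreal (q j))) (mixed_norm (\<lambda>j. ennreal (q j)))"
    and T_trunc: "\<And>f. \<lbrakk>\<forall>i. f i \<in> morrey_space (\<phi>s i) (qs i);
        \<exists>i. f i \<notin> mixed_Lebesgue (\<lambda>j. ennreal (qs i j))\<rbrakk> \<Longrightarrow> truncation_controlled T f"
  shows "bounded_multi T
      (\<lambda>i. morrey_space (\<phi>s i) (qs i)) (\<lambda>i. morrey_norm (\<phi>s i) (qs i))
      (morrey_space \<phi> q) (morrey_norm \<phi> q)"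
proof -
  obtain C where C: "\<And>f x. (\<forall>i. f i \<in> L1_compact) \<Longrightarrow> x \<notin> (\<Inter>i. closed_support (f i)) \<Longrightarrow>
      ennreal (cmod (T f x)) \<le>
        ennreal C * (\<integral>\<^sup>+ y. ennreal ((\<Prod>i\<in>UNIV. cmod (f i (y $ i))) /
          norm (\<chi> i. x - y $ i) ^ (CARD('m) * CARD('n))) \<partial>(lebesgue :: (((real, 'n) vec, 'm) vec) measure))"
    using T_size unfolding size_condition_def by blast
  obtain CT where CT: "\<And>f. (\<forall>i. f i \<in> mixed_Lebesgue (\<lambda>j. ennreal (qs i j))) \<Longrightarrow>
      mixed_norm (\<lambda>j. ennreal (q j)) (T f) \<le>
        ennreal CT * (\<Prod>i\<in>UNIV. mixed_norm (\<lambda>j. ennreal (qs i j)) (f i))"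
    using T_Lebesgue unfolding bounded_multi_def by blast
  have \<phi>s_pos: "0 < \<phi>s i x r" if "0 < r" for i x r
    using \<phi>s[of i] that by (simp add: morrey_weight_def)
  have \<phi>_pos: "0 < \<phi> x r" if "0 < r" for x r
    using \<phi> that by (simp add: morrey_weight_def)
  interpret morrey_operator qs q \<phi>s V T C CT
    by unfold_locales (use qs q \<phi>s_pos V T_sublinear C CT T_trunc in blast)+
  obtain K where K: "K < top" "\<And>f. (\<forall>i. f i \<in> morrey_space (\<phi>s i) (qs i)) \<Longrightarrow>
      morrey_norm \<phi> q (T f) \<le> K * (\<Prod>i\<in>UNIV. morrey_norm (\<phi>s i) (qs i) (f i))"
    using morrey_norm_T_le[OF C0 \<phi>_pos \<phi>s_\<phi>] by blast
  show ?thesis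
    unfolding bounded_multi_def
  \<comment> \<open>A real constant is required; as \<open>K\<close> is finite, the conversion loses
    nothing.\<close>
  proof (intro exI[of _ "enn2real K"] allI impI conjI)
    fix f assume f: "\<forall>i. f i \<in> morrey_space (\<phi>s i) (qs i)"
    show le: "morrey_norm \<phi> q (T f) \<le> ennreal (enn2real K) * (\<Prod>i\<in>UNIV. morrey_norm (\<phi>s i) (qs i) (f i))"
      using K(2)[OF f] K(1) by simp
    have "(\<Prod>i\<in>UNIV. morrey_norm (\<phi>s i) (qs i) (f i)) < top"
      using f by (intro ennreal_prod_less_top) (simp add: morrey_space_def)
    then have "morrey_norm \<phi> q (T f) < top"
      by (intro le_less_trans[OF le]) (simp add: ennreal_mult_less_top)
    moreover have "\<forall>i. f i \<in> V i"
      using f morrey_V by blast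
    then have "T f \<in> borel_measurable lebesgue"
      using T_sublinear unfolding multi_sublinear_def by blast
    ultimately show "T f \<in> morrey_space \<phi> q"
      by (simp add: morrey_space_def)
  qed
qed

end
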